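(* Let $(M,\varphi,\xi,\eta,g)$ be a 3-dimensional almost paracontact metric manifold. Then we have: (i) $M$ is almost $\alpha$-paracosymplectic (respectively $\alpha$-paracosymplectic) if and only if $M\in\mathbb G_6\oplus\mathbb G_{10}$ but $M\notin\mathbb G_{10}$ (respectively $M\in\mathbb G_6$) and $\theta^*(\xi)$ is a function; (ii) $M$ is almost $\alpha$-para-Kenmotsu (respectively $\alpha$-para-Kenmotsu) if and only if $M\in\mathbb G_6\oplus\mathbb G_{10}$ but $M\notin\mathbb G_{10}$ (respectively $M\in\mathbb G_6$) and $\theta^*(\xi)=\mathrm{const}$; (iii) $M$ is almost paracosymplectic (respectively paracosymplectic) if and only if $M\in\mathbb G_{10}$ (respectively $M\in\mathbb G_0$).
   Context: An almost paracontact metric structure on a $(2n+1)$-dimensional manifold $M$ is a quadruple $(\varphi,\xi,\eta,g)$ ($\varphi$ an endomorphism of $TM$, $\xi$ a global vector field, $\eta$ a 1-form, $g$ a pseudo-Riemannian metric) with $\varphi^2=\mathrm{Id}-\eta\otimes\xi$, $\eta(\xi)=1$, $\varphi\xi=0$; the eigensubbundles of $\varphi|_{\operatorname{Ker}\eta}$ for the eigenvalues $1$ and $-1$ both have dimension $n$; and $g(\varphi X,\varphi Y)=-g(X,Y)+\eta(X)\eta(Y)$. Here $n=1$. Notation: $\phi(X,Y)=g(\varphi X,Y)$; $\nabla$ is the Levi-Civita connection; $F(X,Y,Z)=g((\nabla_X\varphi)Y,Z)$; $\theta(X)=\theta_F(X)=g^{ij}F(e_i,e_j,X)$ and $\theta^*(X)=\theta^*_F(X)=g^{ij}F(e_i,\varphi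 e_j,X)$ for a local basis $\{e_i\}$ of $TM$. Conventions: $d\eta(X,Y)=\frac12((\nabla_X\eta)Y-(\nabla_Y\eta)X)$, $d\phi(X,Y,Z)=F(X,Y,Z)+F(Y,Z,X)+F(Z,X,Y)$, $(\eta\wedge\phi)(X,Y,Z)=\eta(X)\phi(Y,Z)+\eta(Y)\phi(Z,X)+\eta(Z)\phi(X,Y)$. Classes ($M$ is in a class if at each point $F$ satisfies the condition): $\mathbb G_5$: $F(X,Y,Z)=\frac{\theta_F(\xi)}{2n}\{\eta(Y)g(\varphi X,\varphi Z)-\eta(Z)g(\varphi X,\varphi Y)\}$; $\mathbb G_6$: $F(X,Y,Z)=-\frac{\theta^*_F(\xi)}{2n}\{\eta(Y)g(X,\varphi Z)-\eta(Z)g(X,\varphi Y)\}$; $\mathbb G_{10}$: $F(X,Y,Z)=-\eta(Y)F(X,Z,\xi)+\eta(Z)F(X,Y,\xi)$ and $F(X,Y,\xi)=F(Y,X,\xi)=F(\varphi X,\varphi Y,\xi)$; $\mathbb G_{12}$: $F(X,Y,Z)=\eta(X)\{\eta(Y)F(\xi,\xi,Z)-\eta(Z)F(\xi,\xi,Y)\}$; $\mathbb G_0$ (the intersection of all basic classes): $F=0$. In dimension 3 every such $F$ is uniquely $F=F^5+F^6+F^{10}+F^{12}$ with $F^i\in\mathbb G_i$; $M\in\mathbb G_i\oplus\mathbb G_j\oplus\cdots$ means $F=F^i+F^j+\cdots$, where $F^i,F^j,\dots$ are the projections of $F$ on $\mathbb G_i,\mathbb G_j,\dots$. $M$ is almost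 $\alpha$-paracosymplectic if $d\eta=0$ and $d\phi=2\alpha\,\eta\wedge\phi$, where $\alpha$ may be a constant or a function on $M$. Subclasses for particular choices of $\alpha$: almost $\alpha$-para-Kenmotsu if $\alpha=\mathrm{const}\neq0$; almost paracosymplectic if $\alpha=0$. If in addition $M$ is normal, i.e. $N(X,Y)-2d\eta(X,Y)\xi=0$ with $N(X,Y)=\varphi^2[X,Y]+[\varphi X,\varphi Y]-\varphi[\varphi X,Y]-\varphi[X,\varphi Y]$, it is called $\alpha$-paracosymplectic, $\alpha$-para-Kenmotsu or paracosymplectic, respectively.
   Formalization: In (i) the almost α-paracosymplectic claim requires α not identically 0, since α=0 forces M in G10; in (ii) the α-para-Kenmotsu case keeps "M not in G10" alongside M in G6, since F=0 would otherwise be a counterexample; in (i) the normal case is proved in both readings. *)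

theory Defs
  imports "HOL-Analysis.Analysis"
begin

section \<open>Smooth manifolds\<close>

text \<open>\<open>Ck_on k S f\<close> is meant for open \<open>S\<close>: all iterated directional derivatives of \<open>f\<close> of order
  less than \<open>k\<close> exist as total derivatives on \<open>S\<close>, and those of order \<open>k\<close> are continuous.\<close>

primrec Ck_on ::
  "nat \<Rightarrow> 'a::euclidean_space set \<Rightarrow> ('a \<Rightarrow> 'b::real_normed_vector) \<Rightarrow> bool" where
  "Ck_on 0 S f = continuous_on S f"
| "Ck_on (Suc k) S f =
     (f differentiable_on S \<and> (\<forall>v. Ck_on k S (\<lambda>x. frechet_derivative f (at x) v)))"

definition smooth_on :: "'a::euclidean_space set \<Rightarrow> ('a \<Rightarrow> 'b::real_normed_vector) \<Rightarrow> bool" where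
  "smooth_on S f \<longleftrightarrow> (\<forall>k. Ck_on k S f)"

text \<open>A chart is a pair of a domain and a coordinate map; the values of the coordinate map outside
  the domain are irrelevant.  The manifold is the whole type \<open>'m\<close>.\<close>

type_synonym ('m, 'e) chart = "'m set \<times> ('m \<Rightarrow> 'e)"

abbreviation dom_of :: "('m, 'e) chart \<Rightarrow> 'm set" where "dom_of c \<equiv> fst c"

abbreviation coord :: "('m, 'e) chart \<Rightarrow> 'm \<Rightarrow> 'e" where "coord c \<equiv> snd c"

definition coord_inv :: "('m, 'e) chart \<Rightarrow> 'e \<Rightarrow> 'm" where
  "coord_inv c = inv_into (dom_of c) (coord c)"

definition is_chart :: "('m::topological_space, 'e::euclidean_space) chart \<Rightarrow> bool" where
  "is_chart c \<longleftrightarrow> open (dom_of c) \<and> open (coord c ` dom_of c) \<and>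
     homeomorphism (dom_of c) (coord c ` dom_of c) (coord c) (coord_inv c)"

definition smooth_atlas ::
  "('m::{t2_space,second_countable_topology}, 'e::euclidean_space) chart set \<Rightarrow> bool" where
  "smooth_atlas A \<longleftrightarrow>
     (\<forall>c\<in>A. is_chart c) \<and> (\<Union>c\<in>A. dom_of c) = UNIV \<and>
     (\<forall>c\<in>A. \<forall>d\<in>A. smooth_on (coord c ` (dom_of c \<inter> dom_of d)) (coord d \<circ> coord_inv c))"

definition smooth_fun ::
  "('m::topological_space, 'e::euclidean_space) chart set \<Rightarrow> 'm set \<Rightarrow> ('m \<Rightarrow> real) \<Rightarrow> bool" where
  "smooth_fun A U f \<longleftrightarrow> (\<forall>c\<in>A. smooth_on (coord c ` (dom_of c \<inter> U)) (f \<circ> coord_inv c))"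


section \<open>Tangent vectors, vector fields, Lie bracket\<close>

text \<open>Each point \<open>p\<close> has a preferred chart \<open>chart_at A p\<close>, and the tangent space at \<open>p\<close> is the model
  space \<open>'e\<close>: a vector \<open>v :: 'e\<close> stands for the tangent vector at \<open>p\<close> whose coordinates in the
  preferred chart of \<open>p\<close> are \<open>v\<close>.  A vector field is a function \<open>'m \<Rightarrow> 'e\<close>.  The preferred chart may
  jump from point to point, so a vector field is smooth if its coordinate expressions in the charts
  (not the function \<open>'m \<Rightarrow> 'e\<close> itself) are smooth.\<close>

definition chart_at :: "('m, 'e) chart set \<Rightarrow> 'm \<Rightarrow> ('m, 'e) chart" where
  "chart_at A p = (SOME c. c \<in> A \<and> p \<in> dom_of c)"

definition to_chart ::
  "('m, 'e::euclidean_space) chart set \<Rightarrow> ('m, 'e) chart \<Rightarrow> 'm \<Rightarrow> 'e \<Rightarrow> 'e" where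
  "to_chart A c p v =
     frechet_derivative (coord c \<circ> coord_inv (chart_at A p)) (at (coord (chart_at A p) p)) v"

definition from_chart ::
  "('m, 'e::euclidean_space) chart set \<Rightarrow> ('m, 'e) chart \<Rightarrow> 'm \<Rightarrow> 'e \<Rightarrow> 'e" where
  "from_chart A c p w =
     frechet_derivative (coord (chart_at A p) \<circ> coord_inv c) (at (coord c p)) w"

definition vf_rep ::
  "('m, 'e::euclidean_space) chart set \<Rightarrow> ('m, 'e) chart \<Rightarrow> ('m \<Rightarrow> 'e) \<Rightarrow> 'e \<Rightarrow> 'e" where
  "vf_rep A c X x = to_chart A c (coord_inv c x) (X (coord_inv c x))"

definition smooth_vf ::
  "('m::topological_space, 'e::euclidean_space) chart set \<Rightarrow> 'm set \<Rightarrow> ('m \<Rightarrow> 'e) \<Rightarrow> bool" where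
  "smooth_vf A U X \<longleftrightarrow> (\<forall>c\<in>A. smooth_on (coord c ` (dom_of c \<inter> U)) (vf_rep A c X))"

text \<open>\<open>const_ext A p y\<close> is the local vector field with constant coordinates \<open>y\<close> in the preferred chart
  of \<open>p\<close>, defined on the domain of that chart; its value at \<open>p\<close> is \<open>y\<close>.\<close>

definition const_ext ::
  "('m, 'e::euclidean_space) chart set \<Rightarrow> 'm \<Rightarrow> 'e \<Rightarrow> 'm \<Rightarrow> 'e" where
  "const_ext A p y = (\<lambda>q. from_chart A (chart_at A p) q y)"

definition dir_deriv ::
  "('m, 'e::euclidean_space) chart set \<Rightarrow> 'm \<Rightarrow> 'e \<Rightarrow> ('m \<Rightarrow> real) \<Rightarrow> real" where
  "dir_deriv A p v f =
     frechet_derivative (f \<circ> coord_inv (chart_at A p)) (at (coord (chart_at A p) p)) v"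

text \<open>The coordinate formula \<open>[X,Y]\<^sup>k = X\<^sup>i \<partial>\<^sub>i Y\<^sup>k - Y\<^sup>i \<partial>\<^sub>i X\<^sup>k\<close> in the preferred chart of \<open>p\<close>.\<close>

definition lie_bracket ::
  "('m, 'e::euclidean_space) chart set \<Rightarrow> ('m \<Rightarrow> 'e) \<Rightarrow> ('m \<Rightarrow> 'e) \<Rightarrow> 'm \<Rightarrow> 'e" where
  "lie_bracket A X Y p =
     (let c = chart_at A p in
        frechet_derivative (vf_rep A c Y) (at (coord c p)) (X p)
      - frechet_derivative (vf_rep A c X) (at (coord c p)) (Y p))"


section \<open>Pseudo-Riemannian metrics and the Levi-Civita connection\<close>

text \<open>Smoothness of a tensor field is tested on smooth vector fields over arbitrary open sets.\<close>

definition pseudo_riemannian_metric ::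
  "('m::topological_space, 'e::euclidean_space) chart set \<Rightarrow> ('m \<Rightarrow> 'e \<Rightarrow> 'e \<Rightarrow> real) \<Rightarrow> bool" where
  "pseudo_riemannian_metric A g \<longleftrightarrow>
     (\<forall>p. bilinear (g p) \<and> (\<forall>x y. g p x y = g p y x) \<and> (\<forall>x. (\<forall>y. g p x y = 0) \<longrightarrow> x = 0)) \<and>
     (\<forall>U X Y. open U \<longrightarrow> smooth_vf A U X \<longrightarrow> smooth_vf A U Y \<longrightarrow>
        smooth_fun A U (\<lambda>q. g q (X q) (Y q)))"

text \<open>\<open>nabla p v Y\<close> is the covariant derivative at \<open>p\<close> of the local vector field \<open>Y\<close> in the direction
  \<open>v\<close>.  It is constrained only for fields that are smooth near \<open>p\<close>, and the last clause says that it
  depends only on the germ of \<open>Y\<close> at \<open>p\<close>.\<close>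

type_synonym ('m, 'e) connection = "'m \<Rightarrow> 'e \<Rightarrow> ('m \<Rightarrow> 'e) \<Rightarrow> 'e"

definition affine_connection ::
  "('m::topological_space, 'e::euclidean_space) chart set \<Rightarrow> ('m, 'e) connection \<Rightarrow> bool" where
  "affine_connection A nabla \<longleftrightarrow>
     (\<forall>U Y p. open U \<longrightarrow> p \<in> U \<longrightarrow> smooth_vf A U Y \<longrightarrow> linear (\<lambda>v. nabla p v Y)) \<and>
     (\<forall>U Y Z p v. open U \<longrightarrow> p \<in> U \<longrightarrow> smooth_vf A U Y \<longrightarrow> smooth_vf A U Z \<longrightarrow>
        nabla p v (\<lambda>q. Y q + Z q) = nabla p v Y + nabla p v Z) \<and>
     (\<forall>U f Y p v. open U \<longrightarrow> p \<in> U \<longrightarrow> smooth_fun A U f \<longrightarrow> smooth_vf A U Y \<longrightarrow>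
        nabla p v (\<lambda>q. f q *\<^sub>R Y q) = dir_deriv A p v f *\<^sub>R Y p + f p *\<^sub>R nabla p v Y) \<and>
     (\<forall>U X Y. open U \<longrightarrow> smooth_vf A U X \<longrightarrow> smooth_vf A U Y \<longrightarrow>
        smooth_vf A U (\<lambda>q. nabla q (X q) Y)) \<and>
     (\<forall>U Y Z p v. open U \<longrightarrow> p \<in> U \<longrightarrow> smooth_vf A U Y \<longrightarrow> (\<forall>q\<in>U. Y q = Z q) \<longrightarrow>
        nabla p v Y = nabla p v Z)"

definition levi_civita ::
  "('m::topological_space, 'e::euclidean_space) chart set \<Rightarrow> ('m \<Rightarrow> 'e \<Rightarrow> 'e \<Rightarrow> real) \<Rightarrow>
     ('m, 'e) connection \<Rightarrow> bool" where
  "levi_civita A g nabla \<longleftrightarrow> affine_connection A nabla \<and>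
     (\<forall>U X Y p. open U \<longrightarrow> p \<in> U \<longrightarrow> smooth_vf A U X \<longrightarrow> smooth_vf A U Y \<longrightarrow>
        nabla p (X p) Y - nabla p (Y p) X = lie_bracket A X Y p) \<and>
     (\<forall>U Y Z p v. open U \<longrightarrow> p \<in> U \<longrightarrow> smooth_vf A U Y \<longrightarrow> smooth_vf A U Z \<longrightarrow>
        dir_deriv A p v (\<lambda>q. g q (Y q) (Z q)) = g p (nabla p v Y) (Z p) + g p (Y p) (nabla p v Z))"


section \<open>Almost paracontact metric structures\<close>

record ('m, 'd) apm_structure =
  atlas :: "('m, real ^ 'd) chart set"
  phi :: "'m \<Rightarrow> real ^ 'd \<Rightarrow> real ^ 'd"
  xi :: "'m \<Rightarrow> real ^ 'd"
  eta :: "'m \<Rightarrow> real ^ 'd \<Rightarrow> real"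
  metric :: "'m \<Rightarrow> real ^ 'd \<Rightarrow> real ^ 'd \<Rightarrow> real"

definition almost_paracontact_metric_manifold ::
  "nat \<Rightarrow> ('m::{t2_space,second_countable_topology}, 'd::finite) apm_structure \<Rightarrow> bool" where
  "almost_paracontact_metric_manifold n M \<longleftrightarrow>
     CARD('d) = 2 * n + 1 \<and>
     smooth_atlas (atlas M) \<and>
     (\<forall>p. linear (phi M p)) \<and>
     (\<forall>U X. open U \<longrightarrow> smooth_vf (atlas M) U X \<longrightarrow> smooth_vf (atlas M) U (\<lambda>q. phi M q (X q))) \<and>
     smooth_vf (atlas M) UNIV (xi M) \<and>
     (\<forall>p. linear (eta M p)) \<and>
     (\<forall>U X. open U \<longrightarrow> smooth_vf (atlas M) U X \<longrightarrow> smooth_fun (atlas M) U (\<lambda>q. eta M q (X q))) \<and>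
     pseudo_riemannian_metric (atlas M) (metric M) \<and>
     (\<forall>p x. phi M p (phi M p x) = x - eta M p x *\<^sub>R xi M p) \<and>
     (\<forall>p. eta M p (xi M p) = 1) \<and>
     (\<forall>p. phi M p (xi M p) = 0) \<and>
     (\<forall>p. dim {x. eta M p x = 0 \<and> phi M p x = x} = n) \<and>
     (\<forall>p. dim {x. eta M p x = 0 \<and> phi M p x = - x} = n) \<and>
     (\<forall>p x y. metric M p (phi M p x) (phi M p y) = - metric M p x y + eta M p x * eta M p y)"

definition Phi ::
  "('m, 'd::finite) apm_structure \<Rightarrow> 'm \<Rightarrow> real ^ 'd \<Rightarrow> real ^ 'd \<Rightarrow> real" where
  "Phi M p x y = metric M p (phi M p x) y"

text \<open>The covariant derivatives of the tensors \<open>\<phi>\<close> and \<open>\<eta>\<close> at a point are computed on the extension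
  \<open>const_ext\<close> of the argument; as they are tensors, any other smooth extension gives the same
  value.\<close>

definition nabla_phi ::
  "('m, 'd::finite) apm_structure \<Rightarrow> ('m, real ^ 'd) connection \<Rightarrow>
     'm \<Rightarrow> real ^ 'd \<Rightarrow> real ^ 'd \<Rightarrow> real ^ 'd" where
  "nabla_phi M nabla p x y =
     (let Y = const_ext (atlas M) p y in
        nabla p x (\<lambda>q. phi M q (Y q)) - phi M p (nabla p x Y))"

definition nabla_eta ::
  "('m, 'd::finite) apm_structure \<Rightarrow> ('m, real ^ 'd) connection \<Rightarrow>
     'm \<Rightarrow> real ^ 'd \<Rightarrow> real ^ 'd \<Rightarrow> real" where
  "nabla_eta M nabla p x y =
     (let Y = const_ext (atlas M) p y in
        dir_deriv (atlas M) p x (\<lambda>q. eta M q (Y q)) - eta M p (nabla p x Y))"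

definition F_tensor ::
  "('m, 'd::finite) apm_structure \<Rightarrow> ('m, real ^ 'd) connection \<Rightarrow>
     'm \<Rightarrow> real ^ 'd \<Rightarrow> real ^ 'd \<Rightarrow> real ^ 'd \<Rightarrow> real" where
  "F_tensor M nabla p x y z = metric M p (nabla_phi M nabla p x y) z"

definition d_eta ::
  "('m, 'd::finite) apm_structure \<Rightarrow> ('m, real ^ 'd) connection \<Rightarrow>
     'm \<Rightarrow> real ^ 'd \<Rightarrow> real ^ 'd \<Rightarrow> real" where
  "d_eta M nabla p x y = (nabla_eta M nabla p x y - nabla_eta M nabla p y x) / 2"

definition d_Phi ::
  "('m, 'd::finite) apm_structure \<Rightarrow> ('m, real ^ 'd) connection \<Rightarrow>
     'm \<Rightarrow> real ^ 'd \<Rightarrow> real ^ 'd \<Rightarrow> real ^ 'd \<Rightarrow> real" where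
  "d_Phi M nabla p x y z =
     F_tensor M nabla p x y z + F_tensor M nabla p y z x + F_tensor M nabla p z x y"

definition eta_wedge_Phi ::
  "('m, 'd::finite) apm_structure \<Rightarrow> 'm \<Rightarrow> real ^ 'd \<Rightarrow> real ^ 'd \<Rightarrow> real ^ 'd \<Rightarrow> real" where
  "eta_wedge_Phi M p x y z =
     eta M p x * Phi M p y z + eta M p y * Phi M p z x + eta M p z * Phi M p x y"


section \<open>The classes of tensors\<close>

type_synonym 'd tensor3 = "real ^ 'd \<Rightarrow> real ^ 'd \<Rightarrow> real ^ 'd \<Rightarrow> real"

definition trilinear :: "('d::finite) tensor3 \<Rightarrow> bool" where
  "trilinear T \<longleftrightarrow> (\<forall>y z. linear (\<lambda>x. T x y z)) \<and> (\<forall>x z. linear (\<lambda>y. T x y z)) \<and>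
     (\<forall>x y. linear (\<lambda>z. T x y z))"

text \<open>The local basis \<open>e\<^sub>i\<close> used for the traces is the coordinate basis of the preferred chart; the
  traces do not depend on the choice of the basis.\<close>

definition g_inv :: "('m, 'd::finite) apm_structure \<Rightarrow> 'm \<Rightarrow> real ^ 'd ^ 'd" where
  "g_inv M p = matrix_inv (\<chi> i j. metric M p (axis i 1) (axis j 1))"

definition theta :: "('m, 'd::finite) apm_structure \<Rightarrow> 'm \<Rightarrow> 'd tensor3 \<Rightarrow> real ^ 'd \<Rightarrow> real" where
  "theta M p T x = (\<Sum>i\<in>UNIV. \<Sum>j\<in>UNIV. g_inv M p $ i $ j * T (axis i 1) (axis j 1) x)"

definition theta_star ::
  "('m, 'd::finite) apm_structure \<Rightarrow> 'm \<Rightarrow> 'd tensor3 \<Rightarrow> real ^ 'd \<Rightarrow> real" where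
  "theta_star M p T x =
     (\<Sum>i\<in>UNIV. \<Sum>j\<in>UNIV. g_inv M p $ i $ j * T (axis i 1) (phi M p (axis j 1)) x)"

datatype basic_class = G5 | G6 | G10 | G12

primrec class_condition ::
  "nat \<Rightarrow> ('m, 'd::finite) apm_structure \<Rightarrow> 'm \<Rightarrow> basic_class \<Rightarrow> 'd tensor3 \<Rightarrow> bool" where
  "class_condition n M p G5 T = (\<forall>x y z. T x y z =
     theta M p T (xi M p) / (2 * real n) *
       (eta M p y * metric M p (phi M p x) (phi M p z)
        - eta M p z * metric M p (phi M p x) (phi M p y)))"
| "class_condition n M p G6 T = (\<forall>x y z. T x y z =
     - theta_star M p T (xi M p) / (2 * real n) *
       (eta M p y * metric M p x (phi M p z) - eta M p z * metric M p x (phi M p y)))"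
| "class_condition n M p G10 T =
     ((\<forall>x y z. T x y z = - eta M p y * T x z (xi M p) + eta M p z * T x y (xi M p)) \<and>
      (\<forall>x y. T x y (xi M p) = T y x (xi M p) \<and>
             T y x (xi M p) = T (phi M p x) (phi M p y) (xi M p)))"
| "class_condition n M p G12 T = (\<forall>x y z. T x y z =
     eta M p x * (eta M p y * T (xi M p) (xi M p) z - eta M p z * T (xi M p) (xi M p) y))"

definition class_at ::
  "nat \<Rightarrow> ('m, 'd::finite) apm_structure \<Rightarrow> 'm \<Rightarrow> basic_class \<Rightarrow> 'd tensor3 set" where
  "class_at n M p C = {T. trilinear T \<and> class_condition n M p C T}"

text \<open>In dimension 3 the classes \<open>G5\<close>, \<open>G6\<close>, \<open>G10\<close>, \<open>G12\<close> give the full decomposition of \<open>F\<close>; the family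
  \<open>D\<close> below consists of the projections of \<open>T\<close> on the four classes.\<close>

definition class_decomposition ::
  "nat \<Rightarrow> ('m, 'd::finite) apm_structure \<Rightarrow> 'm \<Rightarrow> 'd tensor3 \<Rightarrow> (basic_class \<Rightarrow> 'd tensor3) \<Rightarrow> bool"
  where
  "class_decomposition n M p T D \<longleftrightarrow>
     (\<forall>C. D C \<in> class_at n M p C) \<and>
     (\<forall>x y z. T x y z = D G5 x y z + D G6 x y z + D G10 x y z + D G12 x y z)"

definition in_class ::
  "nat \<Rightarrow> ('m, 'd::finite) apm_structure \<Rightarrow> ('m, real ^ 'd) connection \<Rightarrow> basic_class \<Rightarrow> bool" where
  "in_class n M nabla C \<longleftrightarrow> (\<forall>p. F_tensor M nabla p \<in> class_at n M p C)"

definition in_direct_sum ::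
  "nat \<Rightarrow> ('m, 'd::finite) apm_structure \<Rightarrow> ('m, real ^ 'd) connection \<Rightarrow> basic_class set \<Rightarrow> bool" where
  "in_direct_sum n M nabla S \<longleftrightarrow>
     (\<forall>p. \<exists>D. class_decomposition n M p (F_tensor M nabla p) D \<and>
        (\<forall>x y z. F_tensor M nabla p x y z = (\<Sum>C\<in>S. D C x y z)))"

definition in_G0 ::
  "('m, 'd::finite) apm_structure \<Rightarrow> ('m, real ^ 'd) connection \<Rightarrow> bool" where
  "in_G0 M nabla \<longleftrightarrow> (\<forall>p x y z. F_tensor M nabla p x y z = 0)"

definition theta_star_xi ::
  "('m, 'd::finite) apm_structure \<Rightarrow> ('m, real ^ 'd) connection \<Rightarrow> 'm \<Rightarrow> real" where
  "theta_star_xi M nabla p = theta_star M p (F_tensor M nabla p) (xi M p)"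


section \<open>Almost \<open>\<alpha>\<close>-paracosymplectic manifolds\<close>

definition nijenhuis_phi ::
  "('m, 'd::finite) apm_structure \<Rightarrow>
     ('m \<Rightarrow> real ^ 'd) \<Rightarrow> ('m \<Rightarrow> real ^ 'd) \<Rightarrow> 'm \<Rightarrow> real ^ 'd" where
  "nijenhuis_phi M X Y p =
     (let br = lie_bracket (atlas M); \<phi>X = (\<lambda>q. phi M q (X q)); \<phi>Y = (\<lambda>q. phi M q (Y q)) in
        phi M p (phi M p (br X Y p)) + br \<phi>X \<phi>Y p - phi M p (br \<phi>X Y p) - phi M p (br X \<phi>Y p))"

definition normal_structure ::
  "('m::topological_space, 'd::finite) apm_structure \<Rightarrow> ('m, real ^ 'd) connection \<Rightarrow> bool" where
  "normal_structure M nabla \<longleftrightarrow>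
     (\<forall>U X Y p. open U \<longrightarrow> p \<in> U \<longrightarrow> smooth_vf (atlas M) U X \<longrightarrow> smooth_vf (atlas M) U Y \<longrightarrow>
        nijenhuis_phi M X Y p - (2 * d_eta M nabla p (X p) (Y p)) *\<^sub>R xi M p = 0)"

text \<open>The predicates are relative to a given smooth function \<open>\<alpha>\<close>, which may vanish.\<close>

definition almost_alpha_paracosymplectic ::
  "('m::topological_space, 'd::finite) apm_structure \<Rightarrow> ('m, real ^ 'd) connection \<Rightarrow>
     ('m \<Rightarrow> real) \<Rightarrow> bool" where
  "almost_alpha_paracosymplectic M nabla \<alpha> \<longleftrightarrow>
     smooth_fun (atlas M) UNIV \<alpha> \<and>
     (\<forall>p x y. d_eta M nabla p x y = 0) \<and>
     (\<forall>p x y z. d_Phi M nabla p x y z = 2 * \<alpha> p * eta_wedge_Phi M p x y z)"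

definition alpha_paracosymplectic ::
  "('m::topological_space, 'd::finite) apm_structure \<Rightarrow> ('m, real ^ 'd) connection \<Rightarrow>
     ('m \<Rightarrow> real) \<Rightarrow> bool" where
  "alpha_paracosymplectic M nabla \<alpha> \<longleftrightarrow>
     almost_alpha_paracosymplectic M nabla \<alpha> \<and> normal_structure M nabla"

definition almost_alpha_para_Kenmotsu ::
  "('m::topological_space, 'd::finite) apm_structure \<Rightarrow> ('m, real ^ 'd) connection \<Rightarrow> bool" where
  "almost_alpha_para_Kenmotsu M nabla \<longleftrightarrow>
     (\<exists>a. a \<noteq> 0 \<and> almost_alpha_paracosymplectic M nabla (\<lambda>p. a))"

definition alpha_para_Kenmotsu ::
  "('m::topological_space, 'd::finite) apm_structure \<Rightarrow> ('m, real ^ 'd) connection \<Rightarrow> bool" where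
  "alpha_para_Kenmotsu M nabla \<longleftrightarrow>
     almost_alpha_para_Kenmotsu M nabla \<and> normal_structure M nabla"

definition almost_paracosymplectic ::
  "('m::topological_space, 'd::finite) apm_structure \<Rightarrow> ('m, real ^ 'd) connection \<Rightarrow> bool" where
  "almost_paracosymplectic M nabla \<longleftrightarrow> almost_alpha_paracosymplectic M nabla (\<lambda>p. 0)"

definition paracosymplectic ::
  "('m::topological_space, 'd::finite) apm_structure \<Rightarrow> ('m, real ^ 'd) connection \<Rightarrow> bool" where
  "paracosymplectic M nabla \<longleftrightarrow> almost_paracosymplectic M nabla \<and> normal_structure M nabla"

end

theory Submission
  imports Defs
begin

text \<open>At a point take a frame \<open>u, v, \<xi>\<close> with \<open>\<phi> u = u\<close>, \<open>\<phi> v = - v\<close>, \<open>u\<close> and \<open>v\<close> null and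
  \<open>g u v = 1\<close>.  Differentiating the compatibility of \<open>g\<close> and \<open>\<phi>\<close> shows that \<open>F x y z\<close> is skew in
  \<open>y, z\<close> with \<open>F x u v = 0\<close>, so \<open>F\<close> is determined by the bilinear form \<open>S x y = F x y \<xi>\<close>, which has
  six components because \<open>S x \<xi> = 0\<close>.  In these components \<open>d\<eta> = 0\<close> says \<open>S \<xi> u = S \<xi> v = 0\<close> and
  \<open>S u v + S v u = 0\<close>, which is exactly \<open>G6 \<oplus> G10\<close>; \<open>d\<phi> = 2 \<alpha> \<eta> \<and> \<phi>\<close> then says
  \<open>S u v - S v u = 2 \<alpha>\<close>, while \<open>\<theta>\<^sup>* \<xi> = S v u - S u v\<close>, hence \<open>\<theta>\<^sup>* \<xi> = - 2 \<alpha>\<close>.  When \<open>d\<eta> = 0\<close>,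
  normality kills the \<open>G10\<close> components \<open>S u u\<close> and \<open>S v v\<close>.\<close>

subsection \<open>Calculus of \<open>Ck_on\<close>\<close>

lemma differentiable_on_openD:
  "f differentiable_on S \<Longrightarrow> open S \<Longrightarrow> x \<in> S \<Longrightarrow> f differentiable (at x)"
  by (metis at_within_open differentiable_on_def)

text \<open>On an open set the derivative at a point is determined by the values on the set, so
  \<open>f\<close> and \<open>g\<close> share their directional derivatives there and the induction
  passes to these.\<close>

lemma Ck_on_cong:
  assumes "open S" "\<And>x. x \<in> S \<Longrightarrow> f x = g x" "Ck_on k S f"
  shows "Ck_on k S g"
  using assms(2,3)
proof (induction k arbitrary: f g)
  case 0
  then show ?case using continuous_on_cong[of S S f g] by simp
next
  case (Suc k)
  have f: "f differentiable_on S" and Df: "\<And>v. Ck_on k S (\<lambda>x. frechet_derivative f (at x) v)"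
    using Suc.prems by auto
  have "g differentiable (at x)" if "x \<in> S" for x
  proof -
    have "(f has_derivative frechet_derivative f (at x)) (at x)"
      using f \<open>open S\<close> that differentiable_on_openD frechet_derivative_works by blast
    then have "(g has_derivative frechet_derivative f (at x)) (at x)"
      using has_derivative_transform_within_open[OF _ \<open>open S\<close> that] Suc.prems(1) by metis
    then show ?thesis by (auto simp: differentiable_def)
  qed
  then have "g differentiable_on S"
    by (simp add: differentiable_at_imp_differentiable_on)
  moreover have "frechet_derivative f (at x) = frechet_derivative g (at x)" if "x \<in> S" for x
    using frechet_derivative_transform_within_open[of f x S g] f \<open>open S\<close> that
      differentiable_on_openD Suc.prems(1) by blast
  ultimately show ?case using Suc.IH[OF _ Df] by simp
qed

lemma Ck_on_subset: "Ck_on k S f \<Longrightarrow> T \<subseteq> S \<Longrightarrow> Ck_on k T f"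
  by (induction k arbitrary: f) (auto intro: continuous_on_subset differentiable_on_subset)

lemma Ck_on_Suc_imp: "Ck_on (Suc k) S f \<Longrightarrow> Ck_on k S f"
proof (induction k arbitrary: f)
  case 0
  then show ?case by (simp add: differentiable_imp_continuous_on)
next
  case (Suc k)
  show ?case
    using Suc.prems Suc.IH[of "\<lambda>x. frechet_derivative f (at x) v" for v] by simp
qed

text \<open>Lets a later induction supply the derivative by a formula: uniqueness of derivatives
  identifies \<open>D x\<close> with \<open>frechet_derivative f (at x)\<close> on
  \<open>S\<close>.\<close>

lemma Ck_on_SucI:
  assumes "open S" "\<And>x. x \<in> S \<Longrightarrow> (f has_derivative D x) (at x)" "\<And>v. Ck_on k S (\<lambda>x. D x v)"
  shows "Ck_on (Suc k) S f"
proof -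
  have "f differentiable_on S"
    using assms(2) differentiable_at_imp_differentiable_on differentiable_def by blast
  moreover have "D x v = frechet_derivative f (at x) v" if "x \<in> S" for x v
    using frechet_derivative_at[OF assms(2)[OF that]] by simp
  ultimately show ?thesis
    using Ck_on_cong[OF \<open>open S\<close> _ assms(3)] by simp
qed

lemma Ck_on_Suc_has_derivative:
  assumes "open S" "Ck_on (Suc k) S f" "x \<in> S"
  shows "(f has_derivative frechet_derivative f (at x)) (at x)"
  using assms differentiable_on_openD frechet_derivative_works by (metis Ck_on.simps(2))

lemma Ck_on_add:
  assumes "open S" "Ck_on k S f" "Ck_on k S g"
  shows "Ck_on k S (\<lambda>x. f x + g x)"
  using assms(2,3)
proof (induction k arbitrary: f g)
  case 0
  then show ?case by (simp add: continuous_on_add)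
next
  case (Suc k)
  show ?case
  proof (rule Ck_on_SucI[OF \<open>open S\<close>])
    show "((\<lambda>x. f x + g x) has_derivative
        (\<lambda>v. frechet_derivative f (at x) v + frechet_derivative g (at x) v)) (at x)" if "x \<in> S" for x
      using Suc.prems by (intro has_derivative_add Ck_on_Suc_has_derivative[OF \<open>open S\<close> _ that])
  qed (use Suc in simp)
qed

lemma Ck_on_const: "open S \<Longrightarrow> Ck_on k S (\<lambda>x. c)"
proof (induction k arbitrary: c)
  case (Suc k)
  show ?case
    by (rule Ck_on_SucI[OF \<open>open S\<close>, where D="\<lambda>x v. 0"]) (use Suc in auto)
qed simp

lemma Ck_on_sum:
  assumes "open S" "\<And>i. i \<in> I \<Longrightarrow> Ck_on k S (f i)"
  shows "Ck_on k S (\<lambda>x. \<Sum>i\<in>I. f i x)"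
  using assms(2)
  by (induction I rule: infinite_finite_induct) (auto simp: Ck_on_const Ck_on_add \<open>open S\<close>)

lemma Ck_on_bounded_linear:
  assumes "open S" "bounded_linear L" "Ck_on k S f"
  shows "Ck_on k S (\<lambda>x. L (f x))"
  using assms(3)
proof (induction k arbitrary: f)
  case 0
  then show ?case by (simp add: bounded_linear.continuous_on[OF assms(2)])
next
  case (Suc k)
  show ?case
  proof (rule Ck_on_SucI[OF \<open>open S\<close>])
    show "((\<lambda>x. L (f x)) has_derivative (\<lambda>v. L (frechet_derivative f (at x) v))) (at x)"
      if "x \<in> S" for x
      using bounded_linear.has_derivative[OF assms(2)] Ck_on_Suc_has_derivative[OF \<open>open S\<close> _ that]
        Suc.prems by blast
  qed (use Suc in simp)
qed

lemma Ck_on_scaleR: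
  assumes "open S" "Ck_on k S f" "Ck_on k S g"
  shows "Ck_on k S (\<lambda>x. f x *\<^sub>R g x)"
  using assms(2,3)
proof (induction k arbitrary: f g)
  case 0
  then show ?case by (simp add: continuous_on_scaleR)
next
  case (Suc k)
  show ?case
  proof (rule Ck_on_SucI[OF \<open>open S\<close>])
    show "((\<lambda>x. f x *\<^sub>R g x) has_derivative
        (\<lambda>v. f x *\<^sub>R frechet_derivative g (at x) v + frechet_derivative f (at x) v *\<^sub>R g x)) (at x)"
      if "x \<in> S" for x
      using Suc.prems by (intro has_derivative_scaleR Ck_on_Suc_has_derivative[OF \<open>open S\<close> _ that])
  next
    fix v
    have "Ck_on k S f" "Ck_on k S g"
      using Suc.prems Ck_on_Suc_imp by blast+
    then show "Ck_on k S (\<lambda>x. f x *\<^sub>R frechet_derivative g (at x) v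
        + frechet_derivative f (at x) v *\<^sub>R g x)"
      using Suc by (intro Ck_on_add[OF \<open>open S\<close>]) simp_all
  qed
qed

text \<open>In the chain rule the direction \<open>E x v\<close> varies with \<open>x\<close>.
  Expanding it in the basis leaves a sum of products of its coordinates with the compositions
  \<open>D (g x) b\<close> in fixed directions, to which the induction hypothesis applies,
  \<open>g\<close> being kept fixed and \<open>f\<close> arbitrary.\<close>

lemma Ck_on_compose:
  fixes g :: "'a::euclidean_space \<Rightarrow> 'b::euclidean_space"
  assumes "open S" "open T" "g ` S \<subseteq> T" "Ck_on k S g" "Ck_on k T f"
  shows "Ck_on k S (\<lambda>x. f (g x))"
  using assms(4,5)
proof (induction k arbitrary: f)
  case 0
  then show ?case using continuous_on_compose2[of T f S g] assms(3) by simp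
next
  case (Suc k)
  define D where "D x = frechet_derivative f (at x)" for x
  define E where "E x = frechet_derivative g (at x)" for x
  have D: "(f has_derivative D x) (at x)" if "x \<in> T" for x
    unfolding D_def using Ck_on_Suc_has_derivative[OF \<open>open T\<close> Suc.prems(2) that] .
  have E: "(g has_derivative E x) (at x)" if "x \<in> S" for x
    unfolding E_def using Ck_on_Suc_has_derivative[OF \<open>open S\<close> Suc.prems(1) that] .
  show ?case
  proof (rule Ck_on_SucI[OF \<open>open S\<close>])
    show "((\<lambda>x. f (g x)) has_derivative (\<lambda>v. D (g x) (E x v))) (at x)" if "x \<in> S" for x
      using has_derivative_compose[OF E[OF that]] D assms(3) that by blast
  next
    fix v
    have g: "Ck_on k S g" using Suc.prems Ck_on_Suc_imp by blast
    have "Ck_on k S (\<lambda>x. D (g x) b)" for b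
      using Suc.IH[OF g, of "\<lambda>x. D x b"] Suc.prems(2) by (simp add: D_def)
    moreover have "Ck_on k S (\<lambda>x. E x v \<bullet> b)" for b
      using Ck_on_bounded_linear[OF \<open>open S\<close> bounded_linear_inner_left, of k "\<lambda>x. E x v"] Suc.prems(1)
      by (simp add: E_def)
    ultimately have *: "Ck_on k S (\<lambda>x. \<Sum>b\<in>Basis. (E x v \<bullet> b) *\<^sub>R D (g x) b)"
      by (intro Ck_on_sum Ck_on_scaleR \<open>open S\<close>)
    have "(\<Sum>b\<in>Basis. (E x v \<bullet> b) *\<^sub>R D (g x) b) = D (g x) (E x v)" if "x \<in> S" for x
    proof -
      have "linear (D (g x))"
        using D assms(3) that has_derivative_linear by blast
      then have "D (g x) (\<Sum>b\<in>Basis. (E x v \<bullet> b) *\<^sub>R b) = (\<Sum>b\<in>Basis. (E x v \<bullet> b) *\<^sub>R D (g x) b)"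
        by (simp add: linear_sum linear_cmul)
      then show ?thesis by (simp add: euclidean_representation)
    qed
    from Ck_on_cong[OF \<open>open S\<close> this *] show "Ck_on k S (\<lambda>x. D (g x) (E x v))" .
  qed
qed

lemma smooth_on_subset: "smooth_on S f \<Longrightarrow> T \<subseteq> S \<Longrightarrow> smooth_on T f"
  by (auto simp: smooth_on_def intro: Ck_on_subset[of _ S])

lemma smooth_on_cong:
  "open S \<Longrightarrow> (\<And>x. x \<in> S \<Longrightarrow> f x = g x) \<Longrightarrow> smooth_on S f \<Longrightarrow> smooth_on S g"
  using Ck_on_cong[of S f g] by (auto simp: smooth_on_def)

lemma smooth_on_compose:
  fixes g :: "'a::euclidean_space \<Rightarrow> 'b::euclidean_space"
  assumes "open S" "open T" "g ` S \<subseteq> T" "smooth_on S g" "smooth_on T f"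
  shows "smooth_on S (\<lambda>x. f (g x))"
  using assms(4,5) Ck_on_compose[OF assms(1-3), of _ f] by (simp add: smooth_on_def)

lemma smooth_on_directional_derivative:
  "smooth_on S f \<Longrightarrow> smooth_on S (\<lambda>x. frechet_derivative f (at x) v)"
  unfolding smooth_on_def
proof
  assume f: "\<forall>k. Ck_on k S f"
  show "Ck_on k S (\<lambda>x. frechet_derivative f (at x) v)" for k
    using f[rule_format, of "Suc k"] by simp
qed

lemma smooth_on_has_derivative:
  "open S \<Longrightarrow> smooth_on S f \<Longrightarrow> x \<in> S \<Longrightarrow> (f has_derivative frechet_derivative f (at x)) (at x)"
  using Ck_on_Suc_has_derivative[of S 0 f x] by (auto simp: smooth_on_def simp del: Ck_on.simps)

subsection \<open>Charts and coordinate fields\<close>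

context
  fixes A :: "('m::{t2_space,second_countable_topology}, 'e::euclidean_space) chart set"
  assumes A: "smooth_atlas A"
begin

lemma chart_at_in_atlas: "chart_at A p \<in> A" and mem_dom_chart_at: "p \<in> dom_of (chart_at A p)"
proof -
  have "\<exists>c. c \<in> A \<and> p \<in> dom_of c"
    using A unfolding smooth_atlas_def by blast
  then have "chart_at A p \<in> A \<and> p \<in> dom_of (chart_at A p)"
    unfolding chart_at_def by (rule someI_ex)
  then show "chart_at A p \<in> A" "p \<in> dom_of (chart_at A p)" by auto
qed

lemma open_dom: "c \<in> A \<Longrightarrow> open (dom_of c)"
  using A by (simp add: smooth_atlas_def is_chart_def)

lemma coord_inv_coord: "c \<in> A \<Longrightarrow> q \<in> dom_of c \<Longrightarrow> coord_inv c (coord c q) = q"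
  using A by (simp add: smooth_atlas_def is_chart_def homeomorphism_def)

lemma open_coord_image:
  assumes "c \<in> A" "open U"
  shows "open (coord c ` (dom_of c \<inter> U))"
proof -
  have h: "homeomorphism (dom_of c) (coord c ` dom_of c) (coord c) (coord_inv c)"
    and o: "open (coord c ` dom_of c)"
    using A assms(1) by (auto simp: smooth_atlas_def is_chart_def)
  have "openin (top_of_set (dom_of c)) (dom_of c \<inter> U)"
    using assms(2) by (simp add: openin_open_Int)
  then have "openin (top_of_set (coord c ` dom_of c)) (coord c ` (dom_of c \<inter> U))"
    using homeomorphism_imp_open_map[OF h] by blast
  then show ?thesis using o openin_open_trans by blast
qed

lemma transition_smooth:
  "c \<in> A \<Longrightarrow> d \<in> A \<Longrightarrow> smooth_on (coord c ` (dom_of c \<inter> dom_of d)) (coord d \<circ> coord_inv c)"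
  using A by (simp add: smooth_atlas_def)

lemma transition_has_derivative:
  assumes "c \<in> A" "d \<in> A" "q \<in> dom_of c" "q \<in> dom_of d"
  shows "((coord d \<circ> coord_inv c) has_derivative
     frechet_derivative (coord d \<circ> coord_inv c) (at (coord c q))) (at (coord c q))"
  using smooth_on_has_derivative[OF open_coord_image transition_smooth] open_dom assms by blast

text \<open>Both conversions pass through the preferred chart of \<open>q\<close>. By the chain rule
  it cancels, and only the transition map from \<open>c\<close> to \<open>d\<close> remains.\<close>

lemma to_chart_from_chart:
  assumes "c \<in> A" "d \<in> A" "q \<in> dom_of c" "q \<in> dom_of d"
  shows "to_chart A d q (from_chart A c q y) =
    frechet_derivative (coord d \<circ> coord_inv c) (at (coord c q)) y"
proof -
  define b where "b = chart_at A q"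
  have b: "b \<in> A" "q \<in> dom_of b"
    unfolding b_def by (simp_all add: chart_at_in_atlas mem_dom_chart_at)
  let ?S = "coord c ` (dom_of c \<inter> dom_of b)"
  have [simp]: "(coord b \<circ> coord_inv c) (coord c q) = coord b q"
    using assms by (simp add: coord_inv_coord)
  have comp: "((coord d \<circ> coord_inv b) \<circ> (coord b \<circ> coord_inv c) has_derivative
     frechet_derivative (coord d \<circ> coord_inv b) (at (coord b q)) \<circ>
     frechet_derivative (coord b \<circ> coord_inv c) (at (coord c q))) (at (coord c q))"
    using transition_has_derivative[of c b q] transition_has_derivative[of b d q] assms b
    by (intro diff_chain_at) (simp_all add: coord_inv_coord)
  have eq: "((coord d \<circ> coord_inv b) \<circ> (coord b \<circ> coord_inv c)) x = (coord d \<circ> coord_inv c) x"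
    if "x \<in> ?S" for x
    using that assms b by (auto simp: coord_inv_coord)
  have "open ?S" "coord c q \<in> ?S"
    using assms b by (auto simp: open_coord_image open_dom)
  then have "((coord d \<circ> coord_inv c) has_derivative
     frechet_derivative (coord d \<circ> coord_inv b) (at (coord b q)) \<circ>
     frechet_derivative (coord b \<circ> coord_inv c) (at (coord c q))) (at (coord c q))"
    using has_derivative_transform_within_open[OF comp _ _ eq] by blast
  from fun_cong[OF frechet_derivative_at[OF this], of y] show ?thesis
    by (simp add: to_chart_def from_chart_def b_def[symmetric])
qed

lemma const_ext_at: "const_ext A p y p = y"
proof -
  define c where "c = chart_at A p"
  have c: "c \<in> A" "p \<in> dom_of c"
    unfolding c_def by (simp_all add: chart_at_in_atlas mem_dom_chart_at)
  \<comment> \<open>The composition is the identity on the image of the chart domain, which is an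
    open neighbourhood of the point.\<close>
  have "((coord c \<circ> coord_inv c) has_derivative (\<lambda>v. v)) (at (coord c p))"
  proof (rule has_derivative_transform_within_open)
    show "((\<lambda>x. x) has_derivative (\<lambda>v. v)) (at (coord c p))" by simp
    show "open (coord c ` dom_of c)" using open_coord_image[OF c(1), of UNIV] by simp
  qed (use c in \<open>auto simp: coord_inv_coord\<close>)
  from frechet_derivative_at[OF this] show ?thesis
    unfolding const_ext_def from_chart_def c_def[symmetric] by metis
qed

text \<open>By the chain rule the representative of \<open>const_ext A p y\<close> in a chart \<open>d\<close> is a directional
  derivative of a transition map, independently of the preferred charts of the nearby points.\<close>

lemma smooth_vf_const_ext: "smooth_vf A (dom_of (chart_at A p)) (const_ext A p y)"
  unfolding smooth_vf_def
proof
  fix d assume d: "d \<in> A"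
  define c where "c = chart_at A p"
  have c: "c \<in> A" unfolding c_def by (rule chart_at_in_atlas)
  let ?S = "coord d ` (dom_of d \<inter> dom_of c)" and ?T = "coord c ` (dom_of c \<inter> dom_of d)"
  let ?D = "\<lambda>x. frechet_derivative (coord d \<circ> coord_inv c) (at x) y"
  have smooth: "smooth_on ?S (\<lambda>x. ?D ((coord c \<circ> coord_inv d) x))"
  proof (rule smooth_on_compose[where f = ?D])
    show "open ?S" "open ?T"
      using c d by (simp_all add: open_coord_image open_dom)
    show "smooth_on ?S (coord c \<circ> coord_inv d)"
      using c d by (intro transition_smooth)
    show "smooth_on ?T ?D"
      using c d by (intro smooth_on_directional_derivative transition_smooth)
    show "(coord c \<circ> coord_inv d) ` ?S \<subseteq> ?T"
      using d by (auto simp: coord_inv_coord)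
  qed
  have eq: "?D ((coord c \<circ> coord_inv d) x) = vf_rep A d (const_ext A p y) x" if x: "x \<in> ?S" for x
  proof -
    obtain q where "q \<in> dom_of d" "q \<in> dom_of c" "x = coord d q" using x by blast
    then show ?thesis
      using c d by (simp add: vf_rep_def const_ext_def c_def[symmetric] coord_inv_coord to_chart_from_chart)
  qed
  have "open ?S" using c d by (simp add: open_coord_image open_dom)
  from smooth_on_cong[OF this eq smooth] have "smooth_on ?S (vf_rep A d (const_ext A p y))" .
  then show "smooth_on (coord d ` (dom_of d \<inter> dom_of (chart_at A p))) (vf_rep A d (const_ext A p y))"
    by (simp add: c_def)
qed

lemma smooth_vf_subset: "smooth_vf A U X \<Longrightarrow> V \<subseteq> U \<Longrightarrow> smooth_vf A V X"
  unfolding smooth_vf_def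
proof
  fix c assume "\<forall>c\<in>A. smooth_on (coord c ` (dom_of c \<inter> U)) (vf_rep A c X)" "V \<subseteq> U" "c \<in> A"
  then show "smooth_on (coord c ` (dom_of c \<inter> V)) (vf_rep A c X)"
    by (auto intro: smooth_on_subset[of "coord c ` (dom_of c \<inter> U)"])
qed

section \<open>Smooth functions and their directional derivatives\<close>

lemma smooth_fun_const: "smooth_fun A UNIV (\<lambda>p. a)"
  unfolding smooth_fun_def smooth_on_def comp_def by (intro ballI allI Ck_on_const open_coord_image) simp_all

lemma dir_deriv_has_derivative:
  assumes "smooth_fun A U f" "open U" "p \<in> U"
  shows "((f \<circ> coord_inv (chart_at A p)) has_derivative (\<lambda>v. dir_deriv A p v f))
    (at (coord (chart_at A p) p))"
  unfolding dir_deriv_def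
  by (rule smooth_on_has_derivative[of "coord (chart_at A p) ` (dom_of (chart_at A p) \<inter> U)"])
    (use assms in \<open>auto simp: smooth_fun_def chart_at_in_atlas mem_dom_chart_at open_coord_image\<close>)

lemma dir_deriv_eqI:
  assumes "((f \<circ> coord_inv (chart_at A p)) has_derivative D) (at (coord (chart_at A p) p))"
  shows "dir_deriv A p v f = D v"
  using frechet_derivative_at[OF assms] by (simp add: dir_deriv_def)

lemma coord_inv_chart_at [simp]:
  "coord_inv (chart_at A p) (coord (chart_at A p) p) = p"
  by (simp add: chart_at_in_atlas coord_inv_coord mem_dom_chart_at)

end

lemma dir_deriv_minus:
  assumes "smooth_atlas A" "smooth_fun A U f" "open U" "p \<in> U"
  shows "dir_deriv A p v (\<lambda>q. - f q) = - dir_deriv A p v f"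
  using has_derivative_minus[OF dir_deriv_has_derivative[OF assms]]
  by (intro dir_deriv_eqI[OF assms(1)]) (simp add: comp_def)

lemma smooth_fun_cmult:
  assumes "smooth_atlas A" "smooth_fun A UNIV f"
  shows "smooth_fun A UNIV (\<lambda>p. a * f p)"
  unfolding smooth_fun_def smooth_on_def comp_def
proof (intro ballI allI)
  fix c k assume c: "c \<in> A"
  have "Ck_on k (coord c ` (dom_of c \<inter> UNIV)) (f \<circ> coord_inv c)"
    using assms(2) c by (simp add: smooth_fun_def smooth_on_def)
  then show "Ck_on k (coord c ` (dom_of c \<inter> UNIV)) (\<lambda>x. a * f (coord_inv c x))"
    using Ck_on_bounded_linear[OF open_coord_image[OF assms(1) c open_UNIV] bounded_linear_mult_right]
    by (simp add: comp_def)
qed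

subsection \<open>The tensor \<open>F\<close>\<close>

locale apm_manifold_3 =
  fixes M :: "('m::{t2_space,second_countable_topology}, 3) apm_structure"
    and nabla :: "('m, real ^ 3) connection"
  assumes apm: "almost_paracontact_metric_manifold 1 M"
    and lc: "levi_civita (atlas M) (metric M) nabla"
begin

abbreviation "A \<equiv> atlas M"
abbreviation "g \<equiv> metric M"
abbreviation "\<phi> \<equiv> phi M"
abbreviation "\<xi> \<equiv> xi M"
abbreviation "\<eta> \<equiv> eta M"
abbreviation "F \<equiv> F_tensor M nabla"

lemma
  shows atlas: "smooth_atlas A"
    and linear_phi: "linear (\<phi> p)"
    and smooth_phi: "open U \<Longrightarrow> smooth_vf A U X \<Longrightarrow> smooth_vf A U (\<lambda>q. \<phi> q (X q))"
    and linear_eta: "linear (\<eta> p)"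
    and smooth_eta: "open U \<Longrightarrow> smooth_vf A U X \<Longrightarrow> smooth_fun A U (\<lambda>q. \<eta> q (X q))"
    and bilinear_g: "bilinear (g p)"
    and g_sym: "g p x y = g p y x"
    and g_nondegenerate: "(\<And>y. g p x y = 0) \<Longrightarrow> x = 0"
    and smooth_g: "open U \<Longrightarrow> smooth_vf A U X \<Longrightarrow> smooth_vf A U Y \<Longrightarrow>
        smooth_fun A U (\<lambda>q. g q (X q) (Y q))"
    and phi_phi: "\<phi> p (\<phi> p x) = x - \<eta> p x *\<^sub>R \<xi> p"
    and eta_xi [simp]: "\<eta> p (\<xi> p) = 1"
    and phi_xi [simp]: "\<phi> p (\<xi> p) = 0"
    and dim_plus: "dim {x. \<eta> p x = 0 \<and> \<phi> p x = x} = 1"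
    and dim_minus: "dim {x. \<eta> p x = 0 \<and> \<phi> p x = - x} = 1"
    and g_phi_phi: "g p (\<phi> p x) (\<phi> p y) = - g p x y + \<eta> p x * \<eta> p y"
proof -
  note h1 = apm[unfolded almost_paracontact_metric_manifold_def, THEN conjunct2]
  note h2 = h1[THEN conjunct2]
  note h3 = h2[THEN conjunct2]
  note h4 = h3[THEN conjunct2, THEN conjunct2]
  note h5 = h4[THEN conjunct2]
  note h6 = h5[THEN conjunct2]
  note h7 = h6[THEN conjunct2]
  note h8 = h7[THEN conjunct2]
  note h9 = h8[THEN conjunct2]
  note h10 = h9[THEN conjunct2]
  note h11 = h10[THEN conjunct2]
  note metric = h6[THEN conjunct1, unfolded pseudo_riemannian_metric_def]
  show "smooth_atlas A" by (rule h1[THEN conjunct1])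
  show "linear (\<phi> p)" by (rule h2[THEN conjunct1, rule_format])
  show "open U \<Longrightarrow> smooth_vf A U X \<Longrightarrow> smooth_vf A U (\<lambda>q. \<phi> q (X q))"
    by (rule h3[THEN conjunct1, rule_format])
  show "linear (\<eta> p)" by (rule h4[THEN conjunct1, rule_format])
  show "open U \<Longrightarrow> smooth_vf A U X \<Longrightarrow> smooth_fun A U (\<lambda>q. \<eta> q (X q))"
    by (rule h5[THEN conjunct1, rule_format])
  show "bilinear (g p)" by (rule metric[THEN conjunct1, rule_format, THEN conjunct1])
  show "g p x y = g p y x"
    by (rule metric[THEN conjunct1, rule_format, THEN conjunct2, THEN conjunct1, rule_format])
  show "(\<And>y. g p x y = 0) \<Longrightarrow> x = 0"
    by (rule metric[THEN conjunct1, rule_format, THEN conjunct2, THEN conjunct2, rule_format])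
  show "open U \<Longrightarrow> smooth_vf A U X \<Longrightarrow> smooth_vf A U Y \<Longrightarrow> smooth_fun A U (\<lambda>q. g q (X q) (Y q))"
    by (rule metric[THEN conjunct2, rule_format])
  show "\<phi> p (\<phi> p x) = x - \<eta> p x *\<^sub>R \<xi> p" by (rule h7[THEN conjunct1, rule_format])
  show "\<eta> p (\<xi> p) = 1" by (rule h8[THEN conjunct1, rule_format])
  show "\<phi> p (\<xi> p) = 0" by (rule h9[THEN conjunct1, rule_format])
  show "dim {x. \<eta> p x = 0 \<and> \<phi> p x = x} = 1" by (rule h10[THEN conjunct1, rule_format])
  show "dim {x. \<eta> p x = 0 \<and> \<phi> p x = - x} = 1"
    by (rule h11[THEN conjunct1, rule_format])
  show "g p (\<phi> p x) (\<phi> p y) = - g p x y + \<eta> p x * \<eta> p y"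
    by (rule h11[THEN conjunct2, rule_format])
qed

section \<open>Pointwise algebra of the structure\<close>

lemmas g_simps [simp] = bilinear_ladd[OF bilinear_g] bilinear_radd[OF bilinear_g]
  bilinear_lsub[OF bilinear_g] bilinear_rsub[OF bilinear_g]
  bilinear_lmul[OF bilinear_g] bilinear_rmul[OF bilinear_g]
  bilinear_lneg[OF bilinear_g] bilinear_rneg[OF bilinear_g]
  bilinear_lzero[OF bilinear_g] bilinear_rzero[OF bilinear_g]

lemmas phi_simps [simp] = linear_add[OF linear_phi] linear_diff[OF linear_phi]
  linear_cmul[OF linear_phi] linear_neg[OF linear_phi] linear_0[OF linear_phi]

lemmas eta_simps [simp] = linear_add[OF linear_eta] linear_diff[OF linear_eta]
  linear_cmul[OF linear_eta] linear_neg[OF linear_eta] linear_0[OF linear_eta]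

text \<open>Compute the cube of \<phi> in two ways: applying \<phi> to \<open>phi_phi\<close> gives
  \<open>\<phi> p x\<close>, while \<open>phi_phi\<close> at \<open>\<phi> p x\<close> leaves the
  extra term \<open>\<eta> p (\<phi> p x) *\<^sub>R \<xi> p\<close>; and \<xi> is nonzero.\<close>

lemma eta_phi [simp]: "\<eta> p (\<phi> p x) = 0"
proof -
  have "\<xi> p \<noteq> 0" using eta_xi[of p] by force
  moreover have "\<phi> p (\<phi> p (\<phi> p x)) = \<phi> p x" by (simp add: phi_phi[of p x])
  ultimately show ?thesis by (simp add: phi_phi[of p "\<phi> p x"])
qed

text \<open>Insert \<xi> in the compatibility condition; its left side vanishes because \<phi> kills
  \<xi>.\<close>

lemma g_xi [simp]: "g p x (\<xi> p) = \<eta> p x" "g p (\<xi> p) x = \<eta> p x"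
  using g_phi_phi[of p x "\<xi> p"] g_sym[of p "\<xi> p" x] by simp_all

text \<open>Replace \<open>x\<close> by \<open>\<phi> p x\<close> in the compatibility condition;
  the terms with \<eta> drop out by \<open>eta_phi\<close>.\<close>

lemma g_phi_left: "g p (\<phi> p x) y = - g p x (\<phi> p y)"
  using g_phi_phi[of p "\<phi> p x" y] by (simp add: phi_phi)

section \<open>The connection and the covariant derivative of \<phi>\<close>

lemma affine: "affine_connection A nabla"
  using lc by (simp add: levi_civita_def)

lemma linear_nabla: "open U \<Longrightarrow> p \<in> U \<Longrightarrow> smooth_vf A U Y \<Longrightarrow> linear (\<lambda>v. nabla p v Y)"
  by (rule affine[unfolded affine_connection_def, THEN conjunct1, rule_format])

lemma nabla_metric:
  "open U \<Longrightarrow> p \<in> U \<Longrightarrow> smooth_vf A U Y \<Longrightarrow> smooth_vf A U Z \<Longrightarrow>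
    dir_deriv A p v (\<lambda>q. g q (Y q) (Z q)) = g p (nabla p v Y) (Z p) + g p (Y p) (nabla p v Z)"
  by (rule lc[unfolded levi_civita_def, THEN conjunct2, THEN conjunct2, rule_format])

lemma nabla_torsion_free:
  "open U \<Longrightarrow> p \<in> U \<Longrightarrow> smooth_vf A U X \<Longrightarrow> smooth_vf A U Y \<Longrightarrow>
    lie_bracket A X Y p = nabla p (X p) Y - nabla p (Y p) X"
  by (rule lc[unfolded levi_civita_def, THEN conjunct2, THEN conjunct1, rule_format, symmetric])

text \<open>\<open>nabla_phi\<close> sees only coordinate extensions. A version for arbitrary local
  fields is wanted for the Nijenhuis tensor, whose arguments are such fields.\<close>

definition cov_phi :: "'m \<Rightarrow> real ^ 3 \<Rightarrow> ('m \<Rightarrow> real ^ 3) \<Rightarrow> real ^ 3" where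
  "cov_phi p x Y = nabla p x (\<lambda>q. \<phi> q (Y q)) - \<phi> p (nabla p x Y)"

abbreviation "ext \<equiv> const_ext A"
abbreviation "cdom p \<equiv> dom_of (chart_at A p)"

lemma ext_at [simp]: "ext p y p = y"
  by (rule const_ext_at[OF atlas])

lemma cdom [simp]: "open (cdom p)" "p \<in> cdom p"
  using atlas by (simp_all add: chart_at_in_atlas open_dom mem_dom_chart_at)

lemma smooth_ext [simp]: "smooth_vf A (cdom p) (ext p y)"
  by (rule smooth_vf_const_ext[OF atlas])

lemma smooth_phi_ext [simp]: "smooth_vf A (cdom p) (\<lambda>q. \<phi> q (ext p y q))"
  by (simp add: smooth_phi)

lemma F_eq: "F p x y z = g p (cov_phi p x (ext p y)) z"
  by (simp add: F_tensor_def nabla_phi_def cov_phi_def Let_def)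

text \<open>Differentiate the skewness \<open>g_phi_left\<close> along \<open>x\<close>. The
  connection is metric, so the terms with \<open>nabla p x Y\<close> and \<open>nabla p x Z\<close>
  combine with the two derivatives of \<phi>-images into the two values of
  \<open>cov_phi\<close>.\<close>

lemma cov_phi_skew:
  assumes "open U" "p \<in> U" "smooth_vf A U Y" "smooth_vf A U Z"
  shows "g p (cov_phi p x Y) (Z p) = - g p (Y p) (cov_phi p x Z)"
proof -
  have Y: "smooth_vf A U (\<lambda>q. \<phi> q (Y q))" and Z: "smooth_vf A U (\<lambda>q. \<phi> q (Z q))"
    using assms smooth_phi by auto
  have "dir_deriv A p x (\<lambda>q. g q (\<phi> q (Y q)) (Z q)) = dir_deriv A p x (\<lambda>q. - g q (Y q) (\<phi> q (Z q)))"
    by (simp add: g_phi_left)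
  also have "\<dots> = - dir_deriv A p x (\<lambda>q. g q (Y q) (\<phi> q (Z q)))"
    using assms Z by (intro dir_deriv_minus[OF atlas, of U] smooth_g)
  finally show ?thesis
    using nabla_metric[OF assms(1,2) Y assms(4), of x] nabla_metric[OF assms(1-3) Z, of x]
    by (simp add: cov_phi_def g_phi_left)
qed

lemma F_skew: "F p x y z = - F p x z y"
  using cov_phi_skew[of "cdom p" p "ext p y" "ext p z" x] by (simp add: F_eq g_sym)

lemma F_diag [simp]: "F p x y y = 0"
  using F_skew[of p x y y] by simp

text \<open>Skew-symmetry moves the derivative to \<open>ext p z\<close>, so \<open>cov_phi p x Y\<close> depends on \<open>Y p\<close> only.\<close>

lemma cov_phi_tensorial:
  assumes "open U" "p \<in> U" "smooth_vf A U Y"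
  shows "cov_phi p x Y = cov_phi p x (ext p (Y p))"
proof -
  have "g p (cov_phi p x Y) z = F p x (Y p) z" for z
  proof -
    \<comment> \<open>\<open>Y\<close> is smooth on \<open>U\<close> and \<open>ext p z\<close> on
      \<open>cdom p\<close>, so skewness is applied on the intersection.\<close>
    have "g p (cov_phi p x Y) (ext p z p) = - g p (Y p) (cov_phi p x (ext p z))"
      by (rule cov_phi_skew[of "U \<inter> cdom p"])
        (use assms in \<open>auto intro: smooth_vf_subset[OF atlas, of U] smooth_vf_subset[OF atlas, of "cdom p"]\<close>)
    then show ?thesis
      using F_skew[of p x "Y p" z] by (simp add: F_eq g_sym)
  qed
  then have "cov_phi p x Y - cov_phi p x (ext p (Y p)) = 0"
    by (intro g_nondegenerate[of p]) (simp add: F_eq)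
  then show ?thesis by simp
qed

lemma linear_cov_phi:
  assumes "open U" "p \<in> U" "smooth_vf A U Y"
  shows "linear (\<lambda>x. cov_phi p x Y)"
  unfolding cov_phi_def
  using linear_nabla[OF assms] linear_nabla[OF assms(1,2) smooth_phi[OF assms(1,3)]]
  by (intro linear_compose_sub linear_compose[OF _ linear_phi, unfolded comp_def])

text \<open>Linearity in \<open>y\<close> is obtained from linearity in \<open>z\<close> by
  skew-symmetry, which avoids comparing the extensions \<open>ext p y\<close> for different
  \<open>y\<close>.\<close>

lemma trilinear_F: "trilinear (F p)"
proof -
  have 1: "linear (\<lambda>x. F p x y z)" for y z
    using linear_cov_phi[of "cdom p" p "ext p y"] by (auto simp: linear_iff F_eq)
  have 2: "linear (\<lambda>z. F p x y z)" for x y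
    by (auto simp: linear_iff F_eq)
  have "linear (\<lambda>y. - F p x z y)" for x z
    using 2 by (simp add: linear_compose_neg)
  then have 3: "linear (\<lambda>y. F p x y z)" for x z
    by (subst F_skew)
  from 1 2 3 show ?thesis by (simp add: trilinear_def)
qed

text \<open>Differentiate \<open>g (\<phi> Y) (\<phi> Z) = - g Y Z + \<eta> Y * \<eta> Z\<close>.\<close>

lemma F_phi_sym:
  "F p x y (\<phi> p z) + F p x z (\<phi> p y) =
    nabla_eta M nabla p x y * \<eta> p z + \<eta> p y * nabla_eta M nabla p x z"
proof -
  define Y Z where "Y = ext p y" and "Z = ext p z"
  have YZ: "Y p = y" "Z p = z" "smooth_vf A (cdom p) Y" "smooth_vf A (cdom p) Z"
    "smooth_vf A (cdom p) (\<lambda>q. \<phi> q (Y q))" "smooth_vf A (cdom p) (\<lambda>q. \<phi> q (Z q))"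
    by (simp_all add: Y_def Z_def)
  have *: "dir_deriv A p x (\<lambda>q. - g q (Y q) (Z q) + \<eta> q (Y q) * \<eta> q (Z q)) =
      - dir_deriv A p x (\<lambda>q. g q (Y q) (Z q)) +
      (\<eta> p (Y p) * dir_deriv A p x (\<lambda>q. \<eta> q (Z q)) + dir_deriv A p x (\<lambda>q. \<eta> q (Y q)) * \<eta> p (Z p))"
  proof (rule dir_deriv_eqI)
    let ?c = "chart_at A p"
    have D: "((\<lambda>t. f (coord_inv ?c t)) has_derivative (\<lambda>v. dir_deriv A p v f)) (at (coord ?c p))"
      if "smooth_fun A (cdom p) f" for f
      using dir_deriv_has_derivative[OF atlas that] by (simp add: comp_def)
    note G = D[OF smooth_g[OF cdom(1) YZ(3,4)]]
    note E = has_derivative_mult[OF D[OF smooth_eta[OF cdom(1) YZ(3)]] D[OF smooth_eta[OF cdom(1) YZ(4)]]]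
    have inv: "coord_inv ?c (coord ?c p) = p" by (rule coord_inv_chart_at[OF atlas])
    show "((\<lambda>q. - g q (Y q) (Z q) + \<eta> q (Y q) * \<eta> q (Z q)) \<circ> coord_inv ?c has_derivative
        (\<lambda>x. - dir_deriv A p x (\<lambda>q. g q (Y q) (Z q)) +
      (\<eta> p (Y p) * dir_deriv A p x (\<lambda>q. \<eta> q (Z q)) + dir_deriv A p x (\<lambda>q. \<eta> q (Y q)) * \<eta> p (Z p))))
        (at (coord ?c p))"
      using has_derivative_add[OF has_derivative_minus[OF G] E] unfolding inv comp_def .
  qed (rule atlas)
  have "dir_deriv A p x (\<lambda>q. g q (\<phi> q (Y q)) (\<phi> q (Z q))) =
      dir_deriv A p x (\<lambda>q. - g q (Y q) (Z q) + \<eta> q (Y q) * \<eta> q (Z q))"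
    by (simp add: g_phi_phi)
  with * show ?thesis
    using nabla_metric[OF cdom YZ(3,4), of x] nabla_metric[OF cdom YZ(5,6), of x]
    by (simp add: F_eq cov_phi_def nabla_eta_def Let_def Y_def[symmetric] Z_def[symmetric] YZ(1,2)
        g_phi_phi g_sym[of p _ "\<phi> p y"] algebra_simps g_sym[of p _ y])
qed

text \<open>Put \<xi> for \<open>y\<close> in \<open>F_phi_sym\<close>. Taking \<xi> in both places
  shows that the derivative of \<eta> vanishes on \<xi>, which removes the other term on the
  right.\<close>

lemma nabla_eta_F: "nabla_eta M nabla p x y = F p x (\<xi> p) (\<phi> p y)"
proof -
  have 0: "F p x z 0 = 0" for z by (simp add: F_eq)
  show ?thesis
    using F_phi_sym[of p x "\<xi> p" y] F_phi_sym[of p x "\<xi> p" "\<xi> p"] by (simp add: 0)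
qed

text \<open>Torsion-freeness turns the four brackets into eight covariant derivatives, which regroup
  in pairs into four values of \<open>cov_phi\<close>; by tensoriality only \<open>X p\<close> and
  \<open>Y p\<close> enter.\<close>

lemma nijenhuis_F:
  assumes "open U" "p \<in> U" "smooth_vf A U X" "smooth_vf A U Y"
  shows "nijenhuis_phi M X Y p =
    cov_phi p (\<phi> p (X p)) (ext p (Y p)) - cov_phi p (\<phi> p (Y p)) (ext p (X p))
    + \<phi> p (cov_phi p (Y p) (ext p (X p))) - \<phi> p (cov_phi p (X p) (ext p (Y p)))"
proof -
  note s = assms(3,4) smooth_phi[OF assms(1,3)] smooth_phi[OF assms(1,4)]
  note t = cov_phi_tensorial[OF assms(1,2,3)] cov_phi_tensorial[OF assms(1,2,4)]
  note lie = nabla_torsion_free[OF assms(1,2)]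
  show ?thesis
    unfolding nijenhuis_phi_def Let_def lie[OF s(1,2)] lie[OF s(3,4)] lie[OF s(3,2)] lie[OF s(1,4)]
      t[symmetric]
    by (simp add: cov_phi_def)
qed

end

subsection \<open>Components in an adapted frame\<close>

text \<open>A nonzero element of \<open>S\<close> forms an independent subset of size
  \<open>dim S\<close>, so its span contains \<open>S\<close>.\<close>

lemma dim_1_spanned:
  fixes S :: "'a::euclidean_space set"
  assumes "dim S = 1"
  shows "\<exists>u\<in>S. u \<noteq> 0 \<and> (\<forall>w\<in>S. \<exists>a. w = a *\<^sub>R u)"
proof -
  have "\<not> S \<subseteq> {0}" using assms dim_eq_0[of S] by auto
  then obtain u where u: "u \<in> S" "u \<noteq> 0" by auto
  then have "S \<subseteq> span {u}"
    using assms by (intro card_ge_dim_independent) auto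
  then have "\<exists>a. w = a *\<^sub>R u" if "w \<in> S" for w
    using \<open>w \<in> S\<close> by (auto simp: span_singleton)
  then show ?thesis using u by blast
qed

lemma linear_axis_expansion:
  fixes f :: "real ^ 'n \<Rightarrow> real"
  assumes "linear f"
  shows "(\<Sum>j\<in>UNIV. w $ j * f (axis j 1)) = f w"
proof -
  have "f w = f (\<Sum>j\<in>UNIV. w $ j *\<^sub>R axis j 1)"
    using basis_expansion[of w] by (simp add: scalar_mult_eq_scaleR)
  then show ?thesis using assms by (simp add: linear_sum linear_cmul)
qed

text \<open>\<open>matrix_inv\<close> is a choice among two-sided inverses, and associativity forces
  the chosen one to be \<open>B\<close>.\<close>

lemma matrix_inv_unique:
  assumes "A ** B = mat 1" "B ** A = mat 1"
  shows "matrix_inv A = B"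
proof -
  have "A ** matrix_inv A = mat 1 \<and> matrix_inv A ** A = mat 1"
    unfolding matrix_inv_def by (rule someI[of _ B]) (use assms in simp)
  then have "matrix_inv A ** A = mat 1" ..
  then have "B = (matrix_inv A ** A) ** B" by simp
  then show ?thesis by (simp add: assms(1) flip: matrix_mul_assoc)
qed

context apm_manifold_3
begin

text \<open>The last clause stands for the basis property. As \<open>u\<close> and \<open>v\<close>
  are null with product 1, pairing with one of them reads off the coordinate along the
  other.\<close>

definition frame :: "'m \<Rightarrow> real ^ 3 \<Rightarrow> real ^ 3 \<Rightarrow> bool" where
  "frame p u v \<longleftrightarrow> \<phi> p u = u \<and> \<phi> p v = - v \<and> \<eta> p u = 0 \<and> \<eta> p v = 0 \<and>
     g p u u = 0 \<and> g p v v = 0 \<and> g p u v = 1 \<and>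
     (\<forall>x. x = g p x v *\<^sub>R u + g p x u *\<^sub>R v + \<eta> p x *\<^sub>R \<xi> p)"

text \<open>Both eigenspaces of \<phi> in the kernel of \<eta> are lines, and compatibility forces
  \<open>g p u u = - g p u u\<close> on eigenvectors. Together with \<xi> they span, so
  nondegeneracy excludes \<open>g p u v = 0\<close> and \<open>v\<close> can be rescaled.\<close>

lemma frame_exists: "\<exists>u v. frame p u v"
proof -
  obtain u where "u \<in> {x. \<eta> p x = 0 \<and> \<phi> p x = x}" and u0: "u \<noteq> 0"
    and U: "\<And>w. w \<in> {x. \<eta> p x = 0 \<and> \<phi> p x = x} \<Longrightarrow> \<exists>a. w = a *\<^sub>R u"
    using dim_1_spanned[OF dim_plus[of p]] by blast
  then have u: "\<eta> p u = 0" "\<phi> p u = u" by simp_all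
  obtain v where "v \<in> {x. \<eta> p x = 0 \<and> \<phi> p x = - x}"
    and V: "\<And>w. w \<in> {x. \<eta> p x = 0 \<and> \<phi> p x = - x} \<Longrightarrow> \<exists>a. w = a *\<^sub>R v"
    using dim_1_spanned[OF dim_minus[of p]] by blast
  then have v: "\<eta> p v = 0" "\<phi> p v = - v" by simp_all
  have guu: "g p u u = 0" using g_phi_phi[of p u u] u by simp
  have gvv: "g p v v = 0" using g_phi_phi[of p v v] v by simp
  have decomp: "\<exists>a b. x = a *\<^sub>R u + b *\<^sub>R v + \<eta> p x *\<^sub>R \<xi> p" for x
  proof -
    \<comment> \<open>\<open>?y\<close> is the projection of \<open>x\<close> to the kernel of
      \<eta>; \<open>?y + \<phi> p x\<close> and \<open>?y - \<phi> p x\<close> are twice its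
      components in the eigenspaces for 1 and -1.\<close>
    let ?y = "\<phi> p (\<phi> p x)"
    have 3: "\<phi> p ?y = \<phi> p x" using phi_phi[of p "\<phi> p x"] by simp
    obtain a where a: "?y + \<phi> p x = a *\<^sub>R u"
      using U[of "?y + \<phi> p x"] 3 by (auto simp: add.commute)
    obtain b where b: "?y - \<phi> p x = b *\<^sub>R v"
      using V[of "?y - \<phi> p x"] 3 by auto
    have "x - \<eta> p x *\<^sub>R \<xi> p = (1/2) *\<^sub>R ((?y + \<phi> p x) + (?y - \<phi> p x))"
      by (simp add: vec_eq_iff phi_phi)
    also have "\<dots> = (a/2) *\<^sub>R u + (b/2) *\<^sub>R v"
      unfolding a b by (simp add: scaleR_right_distrib)
    finally show ?thesis by (metis diff_eq_eq)
  qed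
  have "g p u v \<noteq> 0"
  proof
    assume guv: "g p u v = 0"
    have "g p u y = 0" for y
    proof -
      obtain a b where "y = a *\<^sub>R u + b *\<^sub>R v + \<eta> p y *\<^sub>R \<xi> p" using decomp by blast
      then have "g p u y = g p u (a *\<^sub>R u + b *\<^sub>R v + \<eta> p y *\<^sub>R \<xi> p)" by metis
      then show ?thesis using guu guv u by simp
    qed
    then show False using g_nondegenerate[of p u] u0 by simp
  qed
  define w where "w = (1 / g p u v) *\<^sub>R v"
  have w: "\<phi> p w = - w" "\<eta> p w = 0" "g p w w = 0" "g p u w = 1"
    using v gvv \<open>g p u v \<noteq> 0\<close> by (simp_all add: w_def)
  have "x = g p x w *\<^sub>R u + g p x u *\<^sub>R w + \<eta> p x *\<^sub>R \<xi> p" for x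
  proof -
    obtain a b where "x = a *\<^sub>R u + b *\<^sub>R v + \<eta> p x *\<^sub>R \<xi> p" using decomp by blast
    then have x: "x = a *\<^sub>R u + (b * g p u v) *\<^sub>R w + \<eta> p x *\<^sub>R \<xi> p"
      using \<open>g p u v \<noteq> 0\<close> by (simp add: w_def)
    have "g p x w = g p (a *\<^sub>R u + (b * g p u v) *\<^sub>R w + \<eta> p x *\<^sub>R \<xi> p) w" using x by metis
    moreover have "g p x u = g p (a *\<^sub>R u + (b * g p u v) *\<^sub>R w + \<eta> p x *\<^sub>R \<xi> p) u" using x by metis
    ultimately have "g p x w = a" "g p x u = b * g p u v"
      using w u guu by (simp_all add: g_sym[of p w u])
    with x show ?thesis by metis
  qed
  then show ?thesis
    using u guu w unfolding frame_def by blast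
qed

abbreviation "S p x y \<equiv> F p x y (\<xi> p)"

lemma F_0 [simp]: "F p 0 y z = 0" "F p x 0 z = 0" "F p x y 0 = 0"
  using trilinear_F[of p] linear_0 unfolding trilinear_def by metis+

lemma F_linear: "linear (\<lambda>x. F p x y z)" "linear (\<lambda>y. F p x y z)" "linear (\<lambda>z. F p x y z)"
  using trilinear_F[of p] by (simp_all add: trilinear_def)

lemma F_phi_linear: "linear (\<lambda>x. F p (\<phi> p x) y z)" "linear (\<lambda>y. F p x (\<phi> p y) z)"
  using linear_compose[OF linear_phi F_linear(1)] linear_compose[OF linear_phi F_linear(2)]
  by (simp_all add: comp_def)

lemma F_neg [simp]: "F p (- x) y z = - F p x y z" "F p x (- y) z = - F p x y z"
    "F p x y (- z) = - F p x y z"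
  using linear_neg[OF F_linear(1)] linear_neg[OF F_linear(2)] linear_neg[OF F_linear(3)] by auto

lemma g_linear: "linear (g p x)" "linear (\<lambda>x. g p x y)"
  using bilinear_g[of p] by (simp_all add: bilinear_def)

context
  fixes p u v
  assumes frame: "frame p u v"
begin

lemma frame_simps [simp]: "\<phi> p u = u" "\<phi> p v = - v" "\<eta> p u = 0" "\<eta> p v = 0"
     "g p u u = 0" "g p v v = 0" "g p u v = 1" "g p v u = 1"
  using frame g_sym[of p v u] by (simp_all add: frame_def)

lemma frame_expansion: "g p x v *\<^sub>R u + g p x u *\<^sub>R v + \<eta> p x *\<^sub>R \<xi> p = x"
  using frame unfolding frame_def by metis

lemma frame_linear_eqI:
  fixes f h :: "real ^ 3 \<Rightarrow> real"
  assumes "linear f" "linear h" "f u = h u" "f v = h v" "f (\<xi> p) = h (\<xi> p)"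
  shows "f x = h x"
proof -
  have "f (g p x v *\<^sub>R u + g p x u *\<^sub>R v + \<eta> p x *\<^sub>R \<xi> p) = h (g p x v *\<^sub>R u + g p x u *\<^sub>R v + \<eta> p x *\<^sub>R \<xi> p)"
    using assms by (simp add: linear_add linear_cmul)
  then show ?thesis by (simp add: frame_expansion)
qed

lemma frame_bilinear_eqI:
  fixes f h :: "real ^ 3 \<Rightarrow> real ^ 3 \<Rightarrow> real"
  assumes "\<And>x. linear (f x)" "\<And>y. linear (\<lambda>x. f x y)" "\<And>x. linear (h x)" "\<And>y. linear (\<lambda>x. h x y)"
    and "\<And>x y. x \<in> {u, v, \<xi> p} \<Longrightarrow> y \<in> {u, v, \<xi> p} \<Longrightarrow> f x y = h x y"
  shows "f x y = h x y"
proof -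
  have "f x y = h x y" if "x \<in> {u, v, \<xi> p}" for x y
    using frame_linear_eqI[OF assms(1)[of x] assms(3)[of x]] assms(5) that by simp
  then show ?thesis
    using frame_linear_eqI[OF assms(2)[of y] assms(4)[of y]] by simp
qed

text \<open>At \<open>u\<close>, \<open>v\<close> the right side of \<open>F_phi_sym\<close>
  vanishes and the identity becomes symmetry in these two arguments, against
  \<open>F_skew\<close>.\<close>

lemma F_uv: "F p x u v = 0" "F p x v u = 0"
  using F_phi_sym[of p x u v] F_skew[of p x u v] by simp_all

text \<open>In dimension 3 the first condition of \<open>G10\<close> is automatic.\<close>

lemma F_reduce: "F p x y z = \<eta> p z * S p x y - \<eta> p y * S p x z"
proof (rule frame_bilinear_eqI[where f = "F p x" and h = "\<lambda>y z. \<eta> p z * S p x y - \<eta> p y * S p x z"])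
  note l = F_linear[THEN linear_add] F_linear[THEN linear_cmul]
  show "linear (F p x y)" "linear (\<lambda>y. F p x y z)" for y z by (rule F_linear)+
  show "linear (\<lambda>z. \<eta> p z * S p x y - \<eta> p y * S p x z)" for y
    by (rule linearI) (simp_all add: l algebra_simps)
  show "linear (\<lambda>y. \<eta> p z * S p x y - \<eta> p y * S p x z)" for z
    by (rule linearI) (simp_all add: l algebra_simps)
  show "F p x y z = \<eta> p z * S p x y - \<eta> p y * S p x z" if "y \<in> {u, v, \<xi> p}" "z \<in> {u, v, \<xi> p}" for y z
    using that F_skew[of p x "\<xi> p"] by (auto simp: F_uv)
qed

lemma S_eqI:
  assumes "\<And>x. linear (h x)" "\<And>y. linear (\<lambda>x. h x y)"
    and "S p u u = h u u" "S p u v = h u v" "S p v u = h v u" "S p v v = h v v"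
      "S p (\<xi> p) u = h (\<xi> p) u" "S p (\<xi> p) v = h (\<xi> p) v" "h u (\<xi> p) = 0" "h v (\<xi> p) = 0" "h (\<xi> p) (\<xi> p) = 0"
  shows "S p x y = h x y"
  by (rule frame_bilinear_eqI[where f = "S p" and h = h]) (use assms in \<open>auto intro: F_linear\<close>)

text \<open>Column \<open>k\<close> of \<open>?K ** ?G\<close> is the frame expansion of
  \<open>axis k 1\<close>, so \<open>?K\<close> inverts the Gram matrix of the coordinate
  basis.\<close>

lemma g_inv_eq: "g_inv M p = (\<chi> i j. u $ i * v $ j + v $ i * u $ j + \<xi> p $ i * \<xi> p $ j)" (is "_ = ?K")
proof -
  let ?G = "(\<chi> i j. g p (axis i 1) (axis j 1)) :: real ^ 3 ^ 3"
  have "(?K ** ?G) $ i $ k = mat 1 $ i $ k" for i k :: 3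
  proof -
    have e: "(\<Sum>j\<in>UNIV. w $ j * g p (axis j 1) (axis k 1)) = g p w (axis k 1)" for w
      by (rule linear_axis_expansion[OF g_linear(2)])
    have "(?K ** ?G) $ i $ k = u $ i * (\<Sum>j\<in>UNIV. v $ j * g p (axis j 1) (axis k 1)) +
        v $ i * (\<Sum>j\<in>UNIV. u $ j * g p (axis j 1) (axis k 1)) +
        \<xi> p $ i * (\<Sum>j\<in>UNIV. \<xi> p $ j * g p (axis j 1) (axis k 1))"
      by (simp add: matrix_matrix_mult_def sum_distrib_left sum.distrib[symmetric] distrib_right mult.assoc)
    also have "\<dots> = u $ i * g p v (axis k 1) + v $ i * g p u (axis k 1) + \<xi> p $ i * g p (\<xi> p) (axis k 1)"
      unfolding e ..
    also have "\<dots> = (g p (axis k 1) v *\<^sub>R u + g p (axis k 1) u *\<^sub>R v + \<eta> p (axis k 1) *\<^sub>R \<xi> p) $ i"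
      by (simp add: g_sym[of p u] g_sym[of p v])
    also have "\<dots> = mat 1 $ i $ k"
      unfolding frame_expansion by (simp add: axis_def mat_def)
    finally show ?thesis .
  qed
  then have KG: "?K ** ?G = mat 1" by (simp add: vec_eq_iff)
  then have "?G ** ?K = mat 1" by (simp add: matrix_left_right_inverse)
  then show ?thesis unfolding g_inv_def by (rule matrix_inv_unique[OF _ KG])
qed

text \<open>Contraction with the inverse metric in frame form gives three terms; \<phi> fixes
  \<open>u\<close>, negates \<open>v\<close> and kills \<xi>.\<close>

lemma theta_star_frame:
  assumes "trilinear T"
  shows "theta_star M p T z = T v u z - T u v z"
proof -
  have lin: "linear (\<lambda>x. T x y z)" "linear (\<lambda>y. T x y z)" for x y
    using assms by (simp_all add: trilinear_def)
  have lin': "linear (\<lambda>y. T x (\<phi> p y) z)" for x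
    using linear_compose[OF linear_phi lin(2)] by (simp add: comp_def)
  have e: "(\<Sum>i\<in>UNIV. \<Sum>j\<in>UNIV. a $ i * b $ j * T (axis i 1) (\<phi> p (axis j 1)) z) = T a (\<phi> p b) z" for a b
  proof -
    have "(\<Sum>i\<in>UNIV. \<Sum>j\<in>UNIV. a $ i * b $ j * T (axis i 1) (\<phi> p (axis j 1)) z) =
        (\<Sum>i\<in>UNIV. a $ i * (\<Sum>j\<in>UNIV. b $ j * T (axis i 1) (\<phi> p (axis j 1)) z))"
      by (simp only: sum_distrib_left mult.assoc)
    also have "\<dots> = (\<Sum>i\<in>UNIV. a $ i * T (axis i 1) (\<phi> p b) z)"
      by (simp only: linear_axis_expansion[OF lin'])
    also have "\<dots> = T a (\<phi> p b) z"
      by (rule linear_axis_expansion[OF lin(1)])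
    finally show ?thesis .
  qed
  have "theta_star M p T z =
      (\<Sum>i\<in>UNIV. \<Sum>j\<in>UNIV. u $ i * v $ j * T (axis i 1) (\<phi> p (axis j 1)) z) +
      (\<Sum>i\<in>UNIV. \<Sum>j\<in>UNIV. v $ i * u $ j * T (axis i 1) (\<phi> p (axis j 1)) z) +
      (\<Sum>i\<in>UNIV. \<Sum>j\<in>UNIV. \<xi> p $ i * \<xi> p $ j * T (axis i 1) (\<phi> p (axis j 1)) z)"
    by (simp add: theta_star_def g_inv_eq distrib_right sum.distrib)
  also have "\<dots> = T u (\<phi> p v) z + T v (\<phi> p u) z + T (\<xi> p) (\<phi> p (\<xi> p)) z"
    unfolding e ..
  finally have "theta_star M p T z = T u (\<phi> p v) z + T v (\<phi> p u) z + T (\<xi> p) (\<phi> p (\<xi> p)) z" .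
  then show ?thesis
    by (simp add: linear_neg[OF lin(2)] linear_0[OF lin(2)])
qed

lemma theta_star_xi_frame: "theta_star_xi M nabla p = S p v u - S p u v"
  by (simp add: theta_star_xi_def theta_star_frame[OF trilinear_F])

section \<open>Class membership in terms of the components of \<open>S\<close>\<close>

lemma G10_iff:
  "F p \<in> class_at 1 M p G10 \<longleftrightarrow>
    S p u v = 0 \<and> S p v u = 0 \<and> S p (\<xi> p) u = 0 \<and> S p (\<xi> p) v = 0"
proof
  assume "F p \<in> class_at 1 M p G10"
  then have S: "S p x y = S p y x" "S p y x = S p (\<phi> p x) (\<phi> p y)" for x y
    unfolding class_at_def class_condition.simps by blast+
  \<comment> \<open>Symmetry exchanges \<open>S p (\<xi> p) u\<close> with
    \<open>S p u (\<xi> p)\<close>, which is zero; invariance under \<phi> gives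
    \<open>S p v u = - S p u v\<close>, and symmetry makes both zero.\<close>
  show "S p u v = 0 \<and> S p v u = 0 \<and> S p (\<xi> p) u = 0 \<and> S p (\<xi> p) v = 0"
    using S(1)[of "\<xi> p" u] S(1)[of "\<xi> p" v] S(1)[of u v] S(2)[of u v] by simp
next
  assume *: "S p u v = 0 \<and> S p v u = 0 \<and> S p (\<xi> p) u = 0 \<and> S p (\<xi> p) v = 0"
  have sym: "S p x y = S p y x" for x y
    by (rule S_eqI[where h = "\<lambda>x y. S p y x"]) (use * in \<open>auto intro: F_linear\<close>)
  have phi: "S p x y = S p (\<phi> p x) (\<phi> p y)" for x y
    by (rule S_eqI[where h = "\<lambda>x y. S p (\<phi> p x) (\<phi> p y)"]) (use * in \<open>auto intro: F_linear F_phi_linear\<close>)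
  show "F p \<in> class_at 1 M p G10"
    unfolding class_at_def class_condition.simps mem_Collect_eq
  proof (intro conjI allI)
    show "trilinear (F p)" by (rule trilinear_F)
    show "F p x y z = - \<eta> p y * S p x z + \<eta> p z * S p x y" for x y z
      by (subst F_reduce) simp
    show "S p x y = S p y x" "S p y x = S p (\<phi> p x) (\<phi> p y)" for x y
      using sym[of x y] phi[of x y] by simp_all
  qed
qed

lemma linear_g_phi: "linear (\<lambda>y. a * g p x (\<phi> p y))" "linear (\<lambda>x. a * g p x (\<phi> p y))"
  by (rule linearI; simp add: algebra_simps)+

text \<open>The right side of the \<open>G6\<close> condition for \<open>n = 1\<close>, with the
  trace of the tensor replaced by a free parameter \<open>t\<close>.\<close>

definition G6_part :: "real \<Rightarrow> 3 tensor3" where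
  "G6_part t x y z = - t / 2 * (\<eta> p y * g p x (\<phi> p z) - \<eta> p z * g p x (\<phi> p y))"

lemma trilinear_G6_part: "trilinear (G6_part t)"
  unfolding trilinear_def G6_part_def by (intro conjI allI; rule linearI; simp add: algebra_simps)

text \<open>The condition refers to the trace of the tensor itself. Evaluated on the frame,
  \<open>u\<close> and \<open>v\<close> contribute \<open>t / 2\<close> each, so that trace is
  indeed \<open>t\<close>.\<close>

lemma G6_part: "G6_part t \<in> class_at 1 M p G6"
proof -
  note tri = trilinear_G6_part[of t]
  have "theta_star M p (G6_part t) (\<xi> p) = t"
    by (simp add: theta_star_frame[OF tri]) (simp add: G6_part_def)
  with tri show ?thesis by (simp add: class_at_def) (simp add: G6_part_def)
qed

lemma class_G6D:
  assumes "T \<in> class_at 1 M p G6"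
  obtains t where "T = G6_part t"
  using assms by (auto simp: class_at_def G6_part_def fun_eq_iff)

text \<open>On the frame \<open>g p x (\<phi> p y)\<close> is 1 at \<open>v, u\<close>, -1 at
  \<open>u, v\<close> and 0 elsewhere, which is the pattern that the assumptions leave for
  \<open>S\<close>.\<close>

lemma S_eq_G6_part:
  assumes "S p (\<xi> p) u = 0" "S p (\<xi> p) v = 0" "S p u v + S p v u = 0" "S p u u = 0" "S p v v = 0"
  shows "S p x y = S p v u * g p x (\<phi> p y)"
  by (rule S_eqI[where h = "\<lambda>x y. S p v u * g p x (\<phi> p y)"]) (use assms in \<open>auto simp: linear_g_phi\<close>)

lemma G6_iff:
  "F p \<in> class_at 1 M p G6 \<longleftrightarrow>
    S p (\<xi> p) u = 0 \<and> S p (\<xi> p) v = 0 \<and> S p u v + S p v u = 0 \<and> S p u u = 0 \<and> S p v v = 0"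
proof
  assume "F p \<in> class_at 1 M p G6"
  then obtain t where F: "F p = G6_part t" by (rule class_G6D)
  then show "S p (\<xi> p) u = 0 \<and> S p (\<xi> p) v = 0 \<and> S p u v + S p v u = 0 \<and> S p u u = 0 \<and> S p v v = 0"
    unfolding F by (simp add: G6_part_def)
next
  assume *: "S p (\<xi> p) u = 0 \<and> S p (\<xi> p) v = 0 \<and> S p u v + S p v u = 0 \<and> S p u u = 0 \<and> S p v v = 0"
  \<comment> \<open>The parameter must be the trace \<open>S p v u - S p u v\<close>, which equals
    \<open>2 * S p v u\<close> here.\<close>
  have "F p x y z = G6_part (2 * S p v u) x y z" for x y z
    using * by (subst F_reduce) (simp add: S_eq_G6_part[of x] G6_part_def algebra_simps)
  then have "F p = G6_part (2 * S p v u)" by blast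
  then show "F p \<in> class_at 1 M p G6" using G6_part by metis
qed

text \<open>With third argument \<xi>, the \<open>G6\<close> summand takes opposite values at
  \<open>u, v\<close> and \<open>v, u\<close> and vanishes at \<open>\<xi>, u\<close> and
  \<open>\<xi>, v\<close>; symmetry and invariance make the \<open>G10\<close> summand vanish at all
  four. Conversely, subtract the \<open>G6\<close> tensor with the trace of
  \<open>F\<close>.\<close>

lemma direct_sum_iff:
  "(\<exists>D. class_decomposition 1 M p (F p) D \<and> (\<forall>x y z. F p x y z = (\<Sum>C\<in>{G6, G10}. D C x y z))) \<longleftrightarrow>
    S p (\<xi> p) u = 0 \<and> S p (\<xi> p) v = 0 \<and> S p u v + S p v u = 0"
proof
  assume "\<exists>D. class_decomposition 1 M p (F p) D \<and> (\<forall>x y z. F p x y z = (\<Sum>C\<in>{G6, G10}. D C x y z))"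
  then obtain D where "class_decomposition 1 M p (F p) D"
    and "\<forall>x y z. F p x y z = (\<Sum>C\<in>{G6, G10}. D C x y z)"
    by blast
  then have D: "D G6 \<in> class_at 1 M p G6" "D G10 \<in> class_at 1 M p G10"
    and F: "F p x y z = D G6 x y z + D G10 x y z" for x y z
    by (simp_all add: class_decomposition_def)
  obtain t where t: "D G6 = G6_part t" using D(1) by (rule class_G6D)
  note D10 = D(2)[unfolded class_at_def class_condition.simps mem_Collect_eq]
  note tri = D10[THEN conjunct1] and cond = D10[THEN conjunct2]
  have red: "D G10 x y z = - \<eta> p y * D G10 x z (\<xi> p) + \<eta> p z * D G10 x y (\<xi> p)"
    and sym: "D G10 x y (\<xi> p) = D G10 y x (\<xi> p)"
    and phi: "D G10 y x (\<xi> p) = D G10 (\<phi> p x) (\<phi> p y) (\<xi> p)" for x y z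
    by (rule cond[THEN conjunct1, rule_format],
        rule cond[THEN conjunct2, rule_format, THEN conjunct1],
        rule cond[THEN conjunct2, rule_format, THEN conjunct2])
  have "linear (\<lambda>y. D G10 u y (\<xi> p))" using tri by (simp add: trilinear_def)
  then have neg: "D G10 u (- v) (\<xi> p) = - D G10 u v (\<xi> p)" by (rule linear_neg)
  have zero: "D G10 x (\<xi> p) (\<xi> p) = 0" for x using red[of x "\<xi> p" "\<xi> p"] by simp
  show "S p (\<xi> p) u = 0 \<and> S p (\<xi> p) v = 0 \<and> S p u v + S p v u = 0"
    using sym[of "\<xi> p" u] sym[of "\<xi> p" v] sym[of u v] phi[of v u]
    by (simp add: F t G6_part_def zero neg)
next
  assume *: "S p (\<xi> p) u = 0 \<and> S p (\<xi> p) v = 0 \<and> S p u v + S p v u = 0"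
  \<comment> \<open>With third argument \<xi>, only the components at \<open>u, u\<close> and
    \<open>v, v\<close> survive in \<open>R\<close>, and these satisfy symmetry and
    \<phi>-invariance.\<close>
  define R where "R x y z = F p x y z - G6_part (2 * S p v u) x y z" for x y z
  have R: "R x y (\<xi> p) = S p x y - S p v u * g p x (\<phi> p y)" for x y
    by (simp add: R_def G6_part_def)
  have lin: "linear (\<lambda>x. R x y z)" "linear (\<lambda>y. R x y z)" "linear (\<lambda>z. R x y z)" for x y z
    using trilinear_G6_part[of "2 * S p v u"] unfolding R_def trilinear_def
    by (simp_all add: linear_compose_sub F_linear)
  have lin_phi: "linear (\<lambda>x. R (\<phi> p x) y z)" "linear (\<lambda>y. R x (\<phi> p y) z)" for x y z
    using linear_compose[OF linear_phi lin(1)] linear_compose[OF linear_phi lin(2)] by (simp_all add: comp_def)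
  have sym: "R x y (\<xi> p) = R y x (\<xi> p)" for x y
    by (rule frame_bilinear_eqI[where f = "\<lambda>x y. R x y (\<xi> p)" and h = "\<lambda>x y. R y x (\<xi> p)"])
      (rule lin | use * in \<open>auto simp: R\<close>)+
  have phi: "R x y (\<xi> p) = R (\<phi> p x) (\<phi> p y) (\<xi> p)" for x y
    by (rule frame_bilinear_eqI[where f = "\<lambda>x y. R x y (\<xi> p)" and h = "\<lambda>x y. R (\<phi> p x) (\<phi> p y) (\<xi> p)"])
      (rule lin lin_phi | use * in \<open>auto simp: R\<close>)+
  have "R \<in> class_at 1 M p G10"
    unfolding class_at_def class_condition.simps mem_Collect_eq
  proof (intro conjI allI)
    show "trilinear R" using lin by (simp add: trilinear_def)
    show "R x y z = - \<eta> p y * R x z (\<xi> p) + \<eta> p z * R x y (\<xi> p)" for x y z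
      unfolding R using F_reduce[of x y z] by (simp add: R_def G6_part_def algebra_simps)
    show "R x y (\<xi> p) = R y x (\<xi> p)" "R y x (\<xi> p) = R (\<phi> p x) (\<phi> p y) (\<xi> p)" for x y
      using sym phi by metis+
  qed
  moreover have "(\<lambda>x y z. 0) \<in> class_at 1 M p G5" "(\<lambda>x y z. 0) \<in> class_at 1 M p G12"
    by (simp_all add: class_at_def trilinear_def theta_def linear_iff)
  moreover define D where "D = case_basic_class (\<lambda>x y z. 0) (G6_part (2 * S p v u)) R (\<lambda>x y z. 0)"
  ultimately have "D C \<in> class_at 1 M p C" for C
    using G6_part by (cases C) (simp_all add: D_def)
  then have "class_decomposition 1 M p (F p) D \<and> (\<forall>x y z. F p x y z = (\<Sum>C\<in>{G6, G10}. D C x y z))"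
    by (simp add: class_decomposition_def D_def R_def)
  then show "\<exists>D. class_decomposition 1 M p (F p) D \<and> (\<forall>x y z. F p x y z = (\<Sum>C\<in>{G6, G10}. D C x y z))"
    by blast
qed

section \<open>Closedness, the differential of the fundamental form, and normality in
  components\<close>

lemma d_eta_eq: "d_eta M nabla p x y = (S p y (\<phi> p x) - S p x (\<phi> p y)) / 2"
  using F_skew[of p x "\<xi> p" "\<phi> p y"] F_skew[of p y "\<xi> p" "\<phi> p x"] by (simp add: d_eta_def nabla_eta_F)

text \<open>By \<open>d_eta_eq\<close>, closedness of \<eta> is the symmetry of
  \<open>S p x (\<phi> p y)\<close> in \<open>x\<close> and \<open>y\<close>; the pairs
  \<open>u, v\<close>, then \<open>u, \<xi>\<close> and \<open>v, \<xi>\<close> carry its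
  content.\<close>

lemma d_eta_iff:
  "(\<forall>x y. d_eta M nabla p x y = 0) \<longleftrightarrow> S p (\<xi> p) u = 0 \<and> S p (\<xi> p) v = 0 \<and> S p u v + S p v u = 0"
proof
  assume "\<forall>x y. d_eta M nabla p x y = 0"
  then have "S p y (\<phi> p x) = S p x (\<phi> p y)" for x y by (simp add: d_eta_eq)
  from this[of u v] this[of u "\<xi> p"] this[of v "\<xi> p"]
  show "S p (\<xi> p) u = 0 \<and> S p (\<xi> p) v = 0 \<and> S p u v + S p v u = 0" by simp
next
  assume *: "S p (\<xi> p) u = 0 \<and> S p (\<xi> p) v = 0 \<and> S p u v + S p v u = 0"
  have "S p y (\<phi> p x) = S p x (\<phi> p y)" for x y
    by (rule frame_bilinear_eqI[where f = "\<lambda>x y. S p y (\<phi> p x)" and h = "\<lambda>x y. S p x (\<phi> p y)"])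
      (use * in \<open>auto intro: F_linear F_phi_linear\<close>)
  then show "\<forall>x y. d_eta M nabla p x y = 0" by (simp add: d_eta_eq)
qed

text \<open>By \<open>F_reduce\<close>, \<open>d_Phi\<close> is the cyclic sum of
  \<open>\<eta> p z * (S p x y - S p y x)\<close>, and \<open>eta_wedge_Phi\<close> that of
  \<open>\<eta> p z * Phi M p x y\<close>. Once \<open>S p (\<xi> p) u\<close> and
  \<open>S p (\<xi> p) v\<close> vanish, the two skew forms can differ only at \<open>u, v\<close>,
  where \<open>Phi\<close> is 1.\<close>

lemma almost_alpha_iff:
  "(\<forall>x y. d_eta M nabla p x y = 0) \<and> (\<forall>x y z. d_Phi M nabla p x y z = 2 * a * eta_wedge_Phi M p x y z) \<longleftrightarrow>
    S p (\<xi> p) u = 0 \<and> S p (\<xi> p) v = 0 \<and> S p u v + S p v u = 0 \<and> S p u v - S p v u = 2 * a"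
proof -
  have "(\<forall>x y z. d_Phi M nabla p x y z = 2 * a * eta_wedge_Phi M p x y z) \<longleftrightarrow> S p u v - S p v u = 2 * a"
    if *: "S p (\<xi> p) u = 0" "S p (\<xi> p) v = 0"
  proof
    assume "\<forall>x y z. d_Phi M nabla p x y z = 2 * a * eta_wedge_Phi M p x y z"
    then have "d_Phi M nabla p (\<xi> p) u v = 2 * a * eta_wedge_Phi M p (\<xi> p) u v" by blast
    then show "S p u v - S p v u = 2 * a"
      using F_skew[of p v "\<xi> p" u] by (simp add: d_Phi_def eta_wedge_Phi_def Phi_def F_uv)
  next
    assume a: "S p u v - S p v u = 2 * a"
    have "S p x y - S p y x = 2 * a * Phi M p x y" for x y
      unfolding Phi_def
      by (rule frame_bilinear_eqI[where f = "\<lambda>x y. S p x y - S p y x" and h = "\<lambda>x y. 2 * a * g p (\<phi> p x) y"])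
        (intro linear_compose_sub F_linear | rule linearI; simp add: algebra_simps | use * a in auto)+
    note S = this[symmetric]
    have "d_Phi M nabla p x y z = \<eta> p z * (S p x y - S p y x) + \<eta> p x * (S p y z - S p z y) + \<eta> p y * (S p z x - S p x z)" for x y z
      using F_reduce[of x y z] F_reduce[of y z x] F_reduce[of z x y]
      by (simp add: d_Phi_def algebra_simps)
    moreover have "2 * a * eta_wedge_Phi M p x y z = \<eta> p z * (2 * a * Phi M p x y) + \<eta> p x * (2 * a * Phi M p y z) + \<eta> p y * (2 * a * Phi M p z x)" for x y z
      by (simp add: eta_wedge_Phi_def algebra_simps)
    ultimately show "\<forall>x y z. d_Phi M nabla p x y z = 2 * a * eta_wedge_Phi M p x y z"
      by (simp add: S)
  qed
  then show ?thesis unfolding d_eta_iff by blast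
qed

lemma g_nijenhuis:
  assumes "open U" "p \<in> U" "smooth_vf A U X" "smooth_vf A U Y" "X p = x" "Y p = y"
  shows "g p (nijenhuis_phi M X Y p) z =
    F p (\<phi> p x) y z - F p (\<phi> p y) x z - F p y x (\<phi> p z) + F p x y (\<phi> p z)"
  using assms(5,6) by (simp add: nijenhuis_F[OF assms(1-4)] F_eq g_phi_left)

text \<open>For closed \<eta>, vanishing of the two components makes \<open>S\<close> a multiple of
  \<open>g p x (\<phi> p y)\<close>. Then the pairing of the Nijenhuis tensor with every
  \<open>z\<close> cancels, and nondegeneracy gives zero.\<close>

lemma nijenhuis_zero_iff:
  assumes "\<forall>x y. d_eta M nabla p x y = 0"
  shows "(\<forall>U X Y. open U \<longrightarrow> p \<in> U \<longrightarrow> smooth_vf A U X \<longrightarrow> smooth_vf A U Y \<longrightarrow> nijenhuis_phi M X Y p = 0) \<longleftrightarrow>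
    S p u u = 0 \<and> S p v v = 0"
proof
  assume N: "\<forall>U X Y. open U \<longrightarrow> p \<in> U \<longrightarrow> smooth_vf A U X \<longrightarrow> smooth_vf A U Y \<longrightarrow> nijenhuis_phi M X Y p = 0"
  have "F p (\<phi> p x) y z - F p (\<phi> p y) x z - F p y x (\<phi> p z) + F p x y (\<phi> p z) = 0" for x y z
    using g_nijenhuis[OF cdom smooth_ext smooth_ext ext_at ext_at, of x y z]
      N[rule_format, OF cdom smooth_ext smooth_ext, of x y] by simp
  \<comment> \<open>The expression is \<open>2 * F p u (\<xi> p) u\<close> at
    \<open>u, \<xi>, u\<close> and \<open>- 2 * F p v (\<xi> p) v\<close> at
    \<open>v, \<xi>, v\<close>.\<close>
  from this[of u "\<xi> p" u] this[of v "\<xi> p" v] show "S p u u = 0 \<and> S p v v = 0"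
    using F_skew[of p u "\<xi> p" u] F_skew[of p v "\<xi> p" v] by simp
next
  assume *: "S p u u = 0 \<and> S p v v = 0"
  define k where "k = S p v u"
  have S: "S p x y = k * g p x (\<phi> p y)" for x y
    unfolding k_def using * assms unfolding d_eta_iff by (intro S_eq_G6_part) auto
  show "\<forall>U X Y. open U \<longrightarrow> p \<in> U \<longrightarrow> smooth_vf A U X \<longrightarrow> smooth_vf A U Y \<longrightarrow> nijenhuis_phi M X Y p = 0"
  proof (intro allI impI g_nondegenerate)
    fix U X Y z assume U: "open U" "p \<in> U" "smooth_vf A U X" "smooth_vf A U Y"
    show "g p (nijenhuis_phi M X Y p) z = 0"
      unfolding g_nijenhuis[OF U refl refl] F_reduce[of _ _ z] F_reduce[of _ _ "\<phi> p z"] S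
      by (simp add: g_phi_left phi_phi g_sym[of p "Y p"] algebra_simps)
  qed
qed

lemma F_zero_iff:
  "(\<forall>x y z. F p x y z = 0) \<longleftrightarrow> S p u u = 0 \<and> S p u v = 0 \<and> S p v u = 0 \<and> S p v v = 0 \<and>
    S p (\<xi> p) u = 0 \<and> S p (\<xi> p) v = 0"
proof (intro iffI allI)
  assume "S p u u = 0 \<and> S p u v = 0 \<and> S p v u = 0 \<and> S p v v = 0 \<and> S p (\<xi> p) u = 0 \<and> S p (\<xi> p) v = 0"
  then have "S p x y = 0" for x y
    using S_eqI[of "\<lambda>x y. 0" x y] by (simp add: linear_iff)
  then show "F p x y z = 0" for x y z by (subst F_reduce) simp
qed simp

end

end

text \<open>As \<open>theta_star_xi\<close> equals -2 \<alpha>, leaving \<open>G10\<close> amounts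
  to \<alpha> being nonzero somewhere. The normal case of (i) is therefore given both with this
  restriction and without it.\<close>

theorem proposition2p2:
  fixes M :: "('m::{t2_space,second_countable_topology}, 3) apm_structure"
    and nabla :: "('m, real ^ 3) connection"
  assumes "almost_paracontact_metric_manifold 1 M"
    and "levi_civita (atlas M) (metric M) nabla"
  shows
    "(((\<exists>\<alpha>. (\<exists>p. \<alpha> p \<noteq> 0) \<and> almost_alpha_paracosymplectic M nabla \<alpha>) \<longleftrightarrow>
        in_direct_sum 1 M nabla {G6, G10} \<and> \<not> in_class 1 M nabla G10 \<and>
        smooth_fun (atlas M) UNIV (theta_star_xi M nabla)) \<and>
      ((\<exists>\<alpha>. (\<exists>p. \<alpha> p \<noteq> 0) \<and> alpha_paracosymplectic M nabla \<alpha>) \<longleftrightarrow>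
        in_class 1 M nabla G6 \<and> \<not> in_class 1 M nabla G10 \<and>
        smooth_fun (atlas M) UNIV (theta_star_xi M nabla)) \<and>
      ((\<exists>\<alpha>. alpha_paracosymplectic M nabla \<alpha>) \<longleftrightarrow>
        in_class 1 M nabla G6 \<and> smooth_fun (atlas M) UNIV (theta_star_xi M nabla))) \<and>
     ((almost_alpha_para_Kenmotsu M nabla \<longleftrightarrow>
        in_direct_sum 1 M nabla {G6, G10} \<and> \<not> in_class 1 M nabla G10 \<and>
        (\<exists>c. \<forall>p. theta_star_xi M nabla p = c)) \<and>
      (alpha_para_Kenmotsu M nabla \<longleftrightarrow>
        in_class 1 M nabla G6 \<and> \<not> in_class 1 M nabla G10 \<and>
        (\<exists>c. \<forall>p. theta_star_xi M nabla p = c))) \<and>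
     ((almost_paracosymplectic M nabla \<longleftrightarrow> in_class 1 M nabla G10) \<and>
      (paracosymplectic M nabla \<longleftrightarrow> in_G0 M nabla))"
proof -
  interpret apm_manifold_3 M nabla using assms by unfold_locales
  \<comment> \<open>The frames are chosen point by point, with no continuity between them; each
    class condition is tested at a single point.\<close>
  obtain u v where fr: "frame p (u p) (v p)" for p using frame_exists by metis
  \<comment> \<open>\<open>closed_at\<close> expresses closedness of \<eta> and also membership in
    the sum of \<open>G6\<close> and \<open>G10\<close>; \<open>normal_at\<close> says that the
    components special to \<open>G10\<close> vanish.\<close>
  define closed_at where "closed_at p \<longleftrightarrow> S p (\<xi> p) (u p) = 0 \<and> S p (\<xi> p) (v p) = 0 \<and>
    S p (u p) (v p) + S p (v p) (u p) = 0" for p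
  define normal_at where "normal_at p \<longleftrightarrow> S p (u p) (u p) = 0 \<and> S p (v p) (v p) = 0" for p
  let ?\<theta> = "theta_star_xi M nabla"
  \<comment> \<open>At a closed point \<open>S p u v + S p v u = 0\<close>, so vanishing of the
    difference \<open>?\<theta> p\<close> is vanishing of both terms.\<close>
  have G10: "in_class 1 M nabla G10 \<longleftrightarrow> (\<forall>p. closed_at p \<and> ?\<theta> p = 0)"
    unfolding in_class_def G10_iff[OF fr] theta_star_xi_frame[OF fr] closed_at_def
    by (rule all_cong1) auto
  have G6: "in_class 1 M nabla G6 \<longleftrightarrow> (\<forall>p. closed_at p \<and> normal_at p)"
    unfolding in_class_def G6_iff[OF fr] closed_at_def normal_at_def by auto
  have sum: "in_direct_sum 1 M nabla {G6, G10} \<longleftrightarrow> (\<forall>p. closed_at p)"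
    unfolding in_direct_sum_def direct_sum_iff[OF fr] closed_at_def ..
  have G0: "in_G0 M nabla \<longleftrightarrow> (\<forall>p. closed_at p \<and> normal_at p \<and> ?\<theta> p = 0)"
    unfolding in_G0_def F_zero_iff[OF fr] closed_at_def normal_at_def theta_star_xi_frame[OF fr]
    by (rule all_cong1) auto
  have almost: "almost_alpha_paracosymplectic M nabla \<alpha> \<longleftrightarrow>
      smooth_fun A UNIV \<alpha> \<and> (\<forall>p. closed_at p) \<and> ?\<theta> = (\<lambda>p. - 2 * \<alpha> p)" for \<alpha>
  proof -
    have "(\<forall>p x y. d_eta M nabla p x y = 0) \<and>
        (\<forall>p x y z. d_Phi M nabla p x y z = 2 * \<alpha> p * eta_wedge_Phi M p x y z) \<longleftrightarrow>
      (\<forall>p. closed_at p \<and> S p (u p) (v p) - S p (v p) (u p) = 2 * \<alpha> p)" (is "?dd \<longleftrightarrow> _")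
      using almost_alpha_iff[OF fr] unfolding closed_at_def by (simp only: all_conj_distrib[symmetric] conj_assoc)
    also have "\<dots> \<longleftrightarrow> (\<forall>p. closed_at p) \<and> ?\<theta> = (\<lambda>p. - 2 * \<alpha> p)"
      unfolding fun_eq_iff theta_star_xi_frame[OF fr] all_conj_distrib[symmetric] by (rule all_cong1) auto
    finally have "?dd \<longleftrightarrow> \<dots>" .
    then show ?thesis unfolding almost_alpha_paracosymplectic_def by (rule arg_cong)
  qed
  \<comment> \<open>Closedness removes the correction term along \<xi>, so normality is vanishing of
    the Nijenhuis tensor.\<close>
  have normal: "normal_structure M nabla \<longleftrightarrow> (\<forall>p. normal_at p)" if "\<forall>p. closed_at p"
  proof -
    have d: "\<forall>x y. d_eta M nabla p x y = 0" for p
      using that unfolding closed_at_def d_eta_iff[OF fr] by blast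
    have "normal_structure M nabla \<longleftrightarrow> (\<forall>p U X Y. open U \<longrightarrow> p \<in> U \<longrightarrow> smooth_vf A U X \<longrightarrow>
        smooth_vf A U Y \<longrightarrow> nijenhuis_phi M X Y p = 0)"
      using d unfolding normal_structure_def by auto
    then show ?thesis
      unfolding nijenhuis_zero_iff[OF fr d] normal_at_def .
  qed
  \<comment> \<open>The only candidate for \<alpha> is \<open>- 1 / 2 * ?\<theta> p\<close>, and
    scaling by a constant preserves smoothness in both directions.\<close>
  have smooth: "smooth_fun A UNIV ?\<theta> \<longleftrightarrow> (\<exists>\<alpha>. smooth_fun A UNIV \<alpha> \<and> ?\<theta> = (\<lambda>p. - 2 * \<alpha> p))"
  proof
    assume "smooth_fun A UNIV ?\<theta>"
    then have "smooth_fun A UNIV (\<lambda>p. - 1 / 2 * ?\<theta> p)" by (rule smooth_fun_cmult[OF atlas])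
    then show "\<exists>\<alpha>. smooth_fun A UNIV \<alpha> \<and> ?\<theta> = (\<lambda>p. - 2 * \<alpha> p)"
      by (intro exI[of _ "\<lambda>p. - 1 / 2 * ?\<theta> p"]) auto
  next
    assume "\<exists>\<alpha>. smooth_fun A UNIV \<alpha> \<and> ?\<theta> = (\<lambda>p. - 2 * \<alpha> p)"
    then show "smooth_fun A UNIV ?\<theta>" using smooth_fun_cmult[OF atlas] by metis
  qed
  have nonzero: "(\<exists>p. ?\<theta> p \<noteq> 0) \<longleftrightarrow> (\<exists>p. \<alpha> p \<noteq> 0)" if "?\<theta> = (\<lambda>p. - 2 * \<alpha> p)" for \<alpha>
    unfolding that by simp
  have const: "smooth_fun A UNIV (\<lambda>p. a)" for a by (rule smooth_fun_const[OF atlas])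
  have alpha: "alpha_paracosymplectic M nabla \<alpha> \<longleftrightarrow>
      smooth_fun A UNIV \<alpha> \<and> (\<forall>p. closed_at p \<and> normal_at p) \<and> ?\<theta> = (\<lambda>p. - 2 * \<alpha> p)" for \<alpha>
    unfolding alpha_paracosymplectic_def almost using normal by auto
  have "(\<exists>\<alpha>. (\<exists>p. \<alpha> p \<noteq> 0) \<and> almost_alpha_paracosymplectic M nabla \<alpha>) \<longleftrightarrow>
        in_direct_sum 1 M nabla {G6, G10} \<and> \<not> in_class 1 M nabla G10 \<and> smooth_fun A UNIV ?\<theta>"
    unfolding almost G10 sum smooth using nonzero by blast
  moreover have "(\<exists>\<alpha>. (\<exists>p. \<alpha> p \<noteq> 0) \<and> alpha_paracosymplectic M nabla \<alpha>) \<longleftrightarrow>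
        in_class 1 M nabla G6 \<and> \<not> in_class 1 M nabla G10 \<and> smooth_fun A UNIV ?\<theta>"
    unfolding alpha G10 G6 smooth using nonzero by blast
  moreover have "(\<exists>\<alpha>. alpha_paracosymplectic M nabla \<alpha>) \<longleftrightarrow> in_class 1 M nabla G6 \<and> smooth_fun A UNIV ?\<theta>"
    unfolding alpha G6 smooth by blast
  moreover have K: "almost_alpha_para_Kenmotsu M nabla \<longleftrightarrow>
      (\<forall>p. closed_at p) \<and> \<not> in_class 1 M nabla G10 \<and> (\<exists>c. \<forall>p. ?\<theta> p = c)"
  proof -
    have "(\<exists>c. \<forall>p. ?\<theta> p = c) \<longleftrightarrow> (\<exists>a. ?\<theta> = (\<lambda>p. - 2 * a))"
    proof
      assume "\<exists>c. \<forall>p. ?\<theta> p = c"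
      then obtain c where "\<forall>p. ?\<theta> p = c" ..
      then show "\<exists>a. ?\<theta> = (\<lambda>p. - 2 * a)" by (intro exI[of _ "- c / 2"]) auto
    qed auto
    moreover have "almost_alpha_para_Kenmotsu M nabla \<longleftrightarrow>
        (\<exists>a. a \<noteq> 0 \<and> (\<forall>p. closed_at p) \<and> ?\<theta> = (\<lambda>p. - 2 * a))"
      unfolding almost_alpha_para_Kenmotsu_def almost using const by simp
    \<comment> \<open>The manifold is a whole type and hence nonempty, so the constant value is
      attained.\<close>
    moreover have "a \<noteq> 0 \<longleftrightarrow> (\<exists>p. ?\<theta> p \<noteq> 0)" if "?\<theta> = (\<lambda>p. - 2 * a)" for a
      using nonzero[OF that] by simp
    ultimately show ?thesis unfolding G10 by blast
  qed
  moreover have "alpha_para_Kenmotsu M nabla \<longleftrightarrow>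
      in_class 1 M nabla G6 \<and> \<not> in_class 1 M nabla G10 \<and> (\<exists>c. \<forall>p. ?\<theta> p = c)"
    unfolding alpha_para_Kenmotsu_def K G6 using normal by auto
  moreover have P: "almost_paracosymplectic M nabla \<longleftrightarrow> in_class 1 M nabla G10"
    unfolding almost_paracosymplectic_def almost G10 by (auto simp: const)
  moreover have "paracosymplectic M nabla \<longleftrightarrow> in_G0 M nabla"
    unfolding paracosymplectic_def P G0 G10 using normal by auto
  ultimately show ?thesis unfolding sum by blast
qed

end
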